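(* Let $\mathbb{K}$ be an algebraically closed field of characteristic $0$ or of prime characteristic $p\ge 7$, and let $m\ge 5$ be an integer, with $m\le p-1$ if $\mathbb{K}$ has characteristic $p$. Let $V$ be the irreducible non-singular curve in $\mathrm{PG}(m-1,\mathbb{K})$ defined by $X_1^k+\cdots+X_m^k=0$ for $1\le k\le m-2$, and let $G\cong\mathrm{Sym}_m$ act on $V$ by permuting the homogeneous coordinates. Let $2\le l\le m-1$, let $j_1,\ldots,j_l$ be pairwise distinct indices in $\{1,\ldots,m\}$, and let $H_l$ be the stabilizer of $(X_{j_1},\ldots,X_{j_l})$ in $G$ (the subgroup fixing each of these $l$ coordinates). Then the quotient curve $V/H_l$ is isomorphic to $\bar V$, where $\bar V$ is the curve obtained by projecting $V$ from the subspace $\Sigma$ of equations $X_{j_1}=\cdots=X_{j_l}=0$ to the subspace $\Sigma'$ of equations $X_i=0$ for all $i\notin\{j_1,\ldots,j_l\}$.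
   Context: The subspace $\Sigma$ has dimension $m-1-l$ and is disjoint from $V$ (no point of $V$ has two vanishing coordinates). The projection from $\Sigma$ to $\Sigma'\cong \mathrm{PG}(l-1,\mathbb{K})$ is the map $(x_1:\cdots:x_m)\mapsto (x_{j_1}:\cdots:x_{j_l})$, and $\bar V$ is the image of $V$ under it. *)

theory Defs
  imports
    "HOL-Analysis.Abstract_Topology"
    "HOL-Computational_Algebra.Polynomial"
    "HOL-Algebra.Group_Action"
    "HOL-Algebra.Sym_Groups"
begin

section \<open>Projective space\<close>

text \<open>
  A vector with coordinates indexed by \<open>{1..n}\<close> is a function on \<open>nat\<close> that is zero outside
  \<open>{1..n}\<close>. The point \<open>(x 1 : ... : x n)\<close> is the set of all nonzero multiples of \<open>x\<close>.
\<close>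

type_synonym 'k ppoint = "(nat \<Rightarrow> 'k) set"

definition hpoint :: "(nat \<Rightarrow> 'k::field) \<Rightarrow> 'k ppoint" where
  "hpoint x = {\<lambda>i. c * x i | c. c \<noteq> 0}"

definition PG :: "nat \<Rightarrow> 'k::field ppoint set" where
  "PG d = {hpoint x | x. (\<forall>i. i \<notin> {1..d+1} \<longrightarrow> x i = 0) \<and> (\<exists>i. x i \<noteq> 0)}"

text \<open>
  Homogeneous polynomials of degree \<open>e\<close> in \<open>X 1, ..., X (d+1)\<close>, given by the functions they
  define (nothing is lost over an infinite field). An exponent vector \<open>a\<close> in \<open>A\<close> stands for the
  monomial with exponents \<open>a 1, ..., a (d+1)\<close>. The zero polynomial is a form of every degree.
\<close>

definition form :: "nat \<Rightarrow> nat \<Rightarrow> ((nat \<Rightarrow> 'k::field) \<Rightarrow> 'k) \<Rightarrow> bool" where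
  "form d e f \<longleftrightarrow>
     (\<exists>(A :: (nat \<Rightarrow> nat) set) c. finite A \<and> (\<forall>a\<in>A. (\<Sum>i=1..d+1. a i) = e) \<and>
        f = (\<lambda>x. \<Sum>a\<in>A. c a * (\<Prod>i=1..d+1. x i ^ a i)))"

text \<open>
  The sets where a form does not vanish are the standard basis of the Zariski topology:
  the closed sets are the common zero loci of families of forms.
\<close>

definition zariski :: "nat \<Rightarrow> 'k::field ppoint topology" where
  "zariski d = topology_generated_by
     {{P \<in> PG d. \<forall>x\<in>P. f x \<noteq> 0} | f. \<exists>e. form d e f}"


section \<open>Varieties as spaces with functions\<close>

text \<open>
  A variety is a topological space with its sheaf of regular functions with values in \<open>'k\<close>.
  Functions are total, so \<open>regular X U\<close> may only depend on their values on the open set \<open>U\<close>.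
\<close>

record ('p, 'k) space_with_functions =
  topol :: "'p topology"
  regular :: "'p set \<Rightarrow> ('p \<Rightarrow> 'k) set"

text \<open>
  The structure induced on a subset of projective space: a function is regular if it is locally
  a quotient of two forms of the same degree.
\<close>

definition variety :: "nat \<Rightarrow> 'k::field ppoint set \<Rightarrow> ('k ppoint, 'k) space_with_functions" where
  "variety d X =
     \<lparr> topol = subtopology (zariski d) X,
       regular = (\<lambda>U. {f. \<forall>P\<in>U. \<exists>W. openin (subtopology (zariski d) X) W \<and> P \<in> W \<and> W \<subseteq> U \<and>
          (\<exists>e a b. form d e a \<and> form d e b \<and>
             (\<forall>Q\<in>W. \<forall>x\<in>Q. b x \<noteq> 0 \<and> f Q = a x / b x))}) \<rparr>"

definition isomorphic ::
  "('p, 'k) space_with_functions \<Rightarrow> ('q, 'k) space_with_functions \<Rightarrow> bool" where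
  "isomorphic X Y \<longleftrightarrow>
     (\<exists>\<phi>. homeomorphic_map (topol X) (topol Y) \<phi> \<and>
        (\<forall>U f. openin (topol Y) U \<longrightarrow>
           (f \<in> regular Y U \<longleftrightarrow>
            f \<circ> \<phi> \<in> regular X {P \<in> topspace (topol X). \<phi> P \<in> U})))"

text \<open>
  The quotient of \<open>X\<close> by \<open>G\<close> acting through \<open>act\<close>: the set of orbits with the quotient topology,
  the regular functions being those whose pullback along the orbit map is regular. The
  functions on an open set of orbits correspond to the \<open>G\<close>-invariant functions on its preimage.
\<close>

definition quotient_variety ::
  "('g, 'z) monoid_scheme \<Rightarrow> ('g \<Rightarrow> 'p \<Rightarrow> 'p) \<Rightarrow> ('p, 'k) space_with_functions \<Rightarrow>
   ('p set, 'k) space_with_functions" where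
  "quotient_variety G act X =
     \<lparr> topol = topology (\<lambda>U. U \<subseteq> orbits G (topspace (topol X)) act \<and>
          openin (topol X) {P \<in> topspace (topol X). orbit G act P \<in> U}),
       regular = (\<lambda>U. {f. f \<circ> orbit G act \<in>
          regular X {P \<in> topspace (topol X). orbit G act P \<in> U}}) \<rparr>"

lemma openin_quotient_variety:
  "openin (topol (quotient_variety G act X)) U \<longleftrightarrow>
     U \<subseteq> orbits G (topspace (topol X)) act \<and>
     openin (topol X) {P \<in> topspace (topol X). orbit G act P \<in> U}"
proof -
  let ?pre = "\<lambda>U. {P \<in> topspace (topol X). orbit G act P \<in> U}"
  have "istopology (\<lambda>U. U \<subseteq> orbits G (topspace (topol X)) act \<and> openin (topol X) (?pre U))"
    unfolding istopology_def
  proof (intro conjI allI impI)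
    fix S T
    assume "S \<subseteq> orbits G (topspace (topol X)) act \<and> openin (topol X) (?pre S)"
      and "T \<subseteq> orbits G (topspace (topol X)) act \<and> openin (topol X) (?pre T)"
    moreover have "?pre (S \<inter> T) = ?pre S \<inter> ?pre T" by blast
    ultimately show "S \<inter> T \<subseteq> orbits G (topspace (topol X)) act"
      and "openin (topol X) (?pre (S \<inter> T))" by auto
  next
    fix K
    assume K: "\<forall>S\<in>K. S \<subseteq> orbits G (topspace (topol X)) act \<and> openin (topol X) (?pre S)"
    show "\<Union>K \<subseteq> orbits G (topspace (topol X)) act" using K by blast
    have "?pre (\<Union>K) = \<Union>(?pre ` K)" by blast
    then show "openin (topol X) (?pre (\<Union>K))" using K by auto
  qed
  then show ?thesis by (simp add: quotient_variety_def topology_inverse')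
qed


section \<open>The curve, its symmetries and its projections\<close>

definition curveV :: "nat \<Rightarrow> 'k::field ppoint set" where
  "curveV m = {P \<in> PG (m-1). \<forall>x\<in>P. \<forall>k\<in>{1..m-2}. (\<Sum>i=1..m. x i ^ k) = 0}"

text \<open>The inverse makes this a left action.\<close>

definition permute_coords :: "(nat \<Rightarrow> nat) \<Rightarrow> 'k ppoint \<Rightarrow> 'k ppoint" where
  "permute_coords p P = (\<lambda>x. x \<circ> inv_into UNIV p) ` P"

text \<open>
  The permutations fixing each of the coordinates \<open>X (j 1), ..., X (j l)\<close>, as a subgroup
  of the symmetric group on \<open>{1..m}\<close>.
\<close>

definition coord_stabilizer :: "nat \<Rightarrow> nat \<Rightarrow> (nat \<Rightarrow> nat) \<Rightarrow> (nat \<Rightarrow> nat) monoid" where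
  "coord_stabilizer m l j =
     (sym_group m) \<lparr> carrier := {p \<in> carrier (sym_group m). \<forall>s\<in>{1..l}. p (j s) = j s} \<rparr>"

text \<open>
  The projection \<open>(x 1 : ... : x m) \<mapsto> (x (j 1) : ... : x (j l))\<close> from the subspace
  \<open>X (j 1) = ... = X (j l) = 0\<close>, applied to all representatives of a point. It is a point of
  \<open>PG (l-1)\<close> whenever the argument is outside that subspace.
\<close>

definition project :: "nat \<Rightarrow> (nat \<Rightarrow> nat) \<Rightarrow> 'k::field ppoint \<Rightarrow> 'k ppoint" where
  "project l j P = (\<lambda>x s. if s \<in> {1..l} then x (j s) else 0) ` P"

end

theory Submission
  imports Defs
begin

text \<open>
  Let \<open>x\<close> be a point of the affine cone over \<open>V\<close>. By Newton's identities its coordinates are the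
  roots of a trinomial \<open>T\<^sup>m + a T + b\<close>, and any two coordinates \<open>u\<close>, \<open>v\<close> determine it:
  \<open>- a\<close> is the complete homogeneous polynomial of degree \<open>m - 1\<close> in \<open>u\<close>, \<open>v\<close>, and
  \<open>b = - u\<^sup>m - a u\<close>. As \<open>l \<ge> 2\<close>, all power sums of the coordinates are therefore forms in the
  coordinates \<open>x (j 1), ..., x (j l)\<close>, and so is, since \<open>(m - l)!\<close> is invertible, the sum of any
  form over the stabilizer. Applied to forms that vanish on all points of a given orbit but one,
  this gives forms in the coordinates of the projection that separate orbits, whose non-vanishing
  sets are a basis of the invariant open sets, and that serve as numerators and denominators of
  the invariant regular functions.
\<close>

section \<open>Forms\<close>

lemma form_monomial: "form d (\<Sum>i=1..d+1. a i) (\<lambda>x. \<Prod>i=1..d+1. x i ^ a i)"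
  unfolding form_def by (rule exI[of _ "{a}"], rule exI[of _ "\<lambda>_. 1"]) simp

lemma form_zero: "form d e (\<lambda>x. 0)"
  unfolding form_def by (intro exI[of _ "{}"]) auto

lemma form_smult:
  assumes "form d e f" shows "form d e (\<lambda>x. r * f x)"
proof -
  obtain A c where A: "finite A" "\<forall>a\<in>A. (\<Sum>i=1..d+1. a i) = e"
    and f: "f = (\<lambda>x. \<Sum>a\<in>A. c a * (\<Prod>i=1..d+1. x i ^ a i))"
    using assms unfolding form_def by blast
  show ?thesis
    unfolding form_def using A
    by (intro exI[of _ A] exI[of _ "\<lambda>a. r * c a"]) (simp add: f sum_distrib_left mult.assoc)
qed

lemma form_add:
  assumes "form d e f" "form d e g" shows "form d e (\<lambda>x. f x + g x)"
proof -
  obtain A c where A: "finite A" "\<forall>a\<in>A. (\<Sum>i=1..d+1. a i) = e"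
    and f: "f = (\<lambda>x. \<Sum>a\<in>A. c a * (\<Prod>i=1..d+1. x i ^ a i))"
    using assms(1) unfolding form_def by blast
  obtain B b where B: "finite B" "\<forall>a\<in>B. (\<Sum>i=1..d+1. a i) = e"
    and g: "g = (\<lambda>x. \<Sum>a\<in>B. b a * (\<Prod>i=1..d+1. x i ^ a i))"
    using assms(2) unfolding form_def by blast
  let ?c = "\<lambda>a. (if a \<in> A then c a else 0) + (if a \<in> B then b a else 0)"
  have "f x + g x = (\<Sum>a\<in>A \<union> B. ?c a * (\<Prod>i=1..d+1. x i ^ a i))" for x
  proof -
    let ?M = "\<lambda>a. \<Prod>i=1..d+1. x i ^ a i"
    have "(\<Sum>a\<in>A \<union> B. (if a \<in> A then c a else 0) * ?M a) = f x"
      unfolding f using A(1) B(1) by (intro sum.mono_neutral_cong_right) auto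
    moreover have "(\<Sum>a\<in>A \<union> B. (if a \<in> B then b a else 0) * ?M a) = g x"
      unfolding g using A(1) B(1) by (intro sum.mono_neutral_cong_right) auto
    ultimately show ?thesis
      by (simp only: distrib_right sum.distrib)
  qed
  then show ?thesis
    unfolding form_def using A B
    by (intro exI[of _ "A \<union> B"] exI[of _ ?c]) auto
qed

lemma form_sum:
  assumes "\<And>s. s \<in> S \<Longrightarrow> form d e (f s)"
  shows "form d e (\<lambda>x. \<Sum>s\<in>S. f s x)"
  using assms
proof (induction S rule: infinite_finite_induct)
  case (insert s S)
  then show ?case using form_add[of d e "f s" "\<lambda>x. \<Sum>s\<in>S. f s x"] by simp
qed (auto simp: form_zero)

lemma form_mult:
  assumes "form d e f" "form d e' g" shows "form d (e + e') (\<lambda>x. f x * g x)"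
proof -
  obtain A c where A: "finite A" "\<forall>a\<in>A. (\<Sum>i=1..d+1. a i) = e"
    and f: "f = (\<lambda>x. \<Sum>a\<in>A. c a * (\<Prod>i=1..d+1. x i ^ a i))"
    using assms(1) unfolding form_def by blast
  obtain B b where B: "finite B" "\<forall>a\<in>B. (\<Sum>i=1..d+1. a i) = e'"
    and g: "g = (\<lambda>x. \<Sum>a\<in>B. b a * (\<Prod>i=1..d+1. x i ^ a i))"
    using assms(2) unfolding form_def by blast
  have "f x * g x = (\<Sum>a\<in>A. \<Sum>a'\<in>B. (c a * b a') * (\<Prod>i=1..d+1. x i ^ (a i + a' i)))" for x
    unfolding f g sum_product power_add prod.distrib by (simp add: ac_simps)
  moreover have "form d (e + e') (\<lambda>x. \<Prod>i=1..d+1. x i ^ (a i + a' i) :: 'a)"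
    if "a \<in> A" "a' \<in> B" for a a'
    using form_monomial[of d "\<lambda>i. a i + a' i"] that A B by (simp add: sum.distrib)
  ultimately show ?thesis
    by (simp only:) (intro form_sum form_smult, auto)
qed

lemma form_const: "form d 0 (\<lambda>x. r)"
  using form_smult[OF form_monomial[of d "\<lambda>_. 0"], of r] by simp

lemma form_coord:
  assumes "i \<in> {1..d+1}" shows "form d 1 (\<lambda>x. x i)"
proof -
  have "(\<Sum>k=1..d+1. if k = i then 1 else 0 :: nat) = 1"
    using assms by simp
  moreover have "(\<Prod>k=1..d+1. x k ^ (if k = i then 1 else 0)) = x i" for x :: "nat \<Rightarrow> 'a"
    using assms by (simp add: if_distrib[of "power _"] cong: if_cong)
  ultimately show ?thesis
    using form_monomial[of d "\<lambda>k. if k = i then 1 else 0", where ?'a = 'a] by (simp cong: if_cong)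
qed

lemma form_power:
  assumes "form d e f" shows "form d (e * n) (\<lambda>x. f x ^ n)"
proof (induction n)
  case 0 show ?case by (simp add: form_const)
next
  case (Suc n) show ?case using form_mult[OF assms Suc] by simp
qed

lemma form_prod:
  assumes "\<And>s. s \<in> S \<Longrightarrow> form d (e s) (f s)"
  shows "form d (\<Sum>s\<in>S. e s) (\<lambda>x. \<Prod>s\<in>S. f s x)"
  using assms
proof (induction S rule: infinite_finite_induct)
  case (insert s S)
  then show ?case using form_mult[of d "e s" "f s" _ "\<lambda>x. \<Prod>s\<in>S. f s x"] by simp
qed (auto simp: form_const)

text \<open>Each monomial becomes a product of powers of linear forms, so the degree is kept. The
  case of interest is composition with the coordinate projection.\<close>

lemma form_substitute_coords:
  assumes "form d e f" and v: "\<And>i. i \<in> {1..d+1} \<Longrightarrow> form d' 1 (\<lambda>x. v x i)"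
  shows "form d' e (\<lambda>x. f (v x))"
proof -
  obtain A c where A: "finite A" "\<forall>a\<in>A. (\<Sum>i=1..d+1. a i) = e"
    and f: "f = (\<lambda>x. \<Sum>a\<in>A. c a * (\<Prod>i=1..d+1. x i ^ a i))"
    using assms(1) unfolding form_def by blast
  have "form d' e (\<lambda>x. \<Prod>i=1..d+1. v x i ^ a i)" if "a \<in> A" for a
  proof -
    have "form d' (1 * a i) (\<lambda>x. v x i ^ a i)" if "i \<in> {1..d+1}" for i
      by (intro form_power v that)
    then have "form d' (\<Sum>i=1..d+1. 1 * a i) (\<lambda>x. \<Prod>i=1..d+1. v x i ^ a i)"
      by (rule form_prod)
    then show ?thesis using A that by simp
  qed
  then show ?thesis unfolding f by (intro form_sum form_smult)
qed

lemma form_homogeneous: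
  assumes "form d e f" shows "f (\<lambda>i. r * x i) = r ^ e * f x"
proof -
  obtain A c where A: "\<forall>a\<in>A. (\<Sum>i=1..d+1. a i) = e"
    and f: "f = (\<lambda>x. \<Sum>a\<in>A. c a * (\<Prod>i=1..d+1. x i ^ a i))"
    using assms unfolding form_def by blast
  have "(\<Prod>i=1..d+1. (r * x i) ^ a i) = r ^ e * (\<Prod>i=1..d+1. x i ^ a i)" if "a \<in> A" for a
    using A that by (simp only: power_mult_distrib prod.distrib power_sum[symmetric])
  then show ?thesis
    unfolding f sum_distrib_left by (intro sum.cong) (simp_all add: mult.left_commute)
qed


section \<open>Points and open sets\<close>

lemma hpoint_self: "x \<in> hpoint x"
  unfolding hpoint_def by (auto intro!: exI[of _ 1])

lemma hpoint_eq_iff: "hpoint x = hpoint y \<longleftrightarrow> (\<exists>c. c \<noteq> 0 \<and> y = (\<lambda>i. c * x i))"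
proof
  assume "hpoint x = hpoint y"
  then show "\<exists>c. c \<noteq> 0 \<and> y = (\<lambda>i. c * x i)"
    using hpoint_self[of y] unfolding hpoint_def by auto
next
  assume "\<exists>c. c \<noteq> 0 \<and> y = (\<lambda>i. c * x i)"
  then obtain c where c: "c \<noteq> 0" "y = (\<lambda>i. c * x i)" by blast
  have sub: "hpoint (\<lambda>i. r * v i) \<subseteq> hpoint v" if "r \<noteq> 0" for r and v :: "nat \<Rightarrow> 'a"
  proof
    fix z assume "z \<in> hpoint (\<lambda>i. r * v i)"
    then obtain b where "b \<noteq> 0" "z = (\<lambda>i. b * (r * v i))" unfolding hpoint_def by blast
    then have "z = (\<lambda>i. (b * r) * v i)" "b * r \<noteq> 0" using that by (simp_all add: mult.assoc)
    then show "z \<in> hpoint v" unfolding hpoint_def by blast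
  qed
  have "x = (\<lambda>i. inverse c * y i)" using c by (simp add: mult.assoc[symmetric])
  then have "hpoint x \<subseteq> hpoint y" using sub[of "inverse c" y] c(1) by simp
  moreover have "hpoint y \<subseteq> hpoint x" using sub[of c x] c by simp
  ultimately show "hpoint x = hpoint y" by blast
qed

lemma PG_E:
  assumes "P \<in> PG d" "x \<in> P"
  shows "P = hpoint x" "\<And>i. i \<notin> {1..d+1} \<Longrightarrow> x i = 0" "\<exists>i. x i \<noteq> 0"
proof -
  obtain y where P: "P = hpoint y" and y: "\<forall>i. i \<notin> {1..d+1} \<longrightarrow> y i = 0" "\<exists>i. y i \<noteq> 0"
    using assms(1) unfolding PG_def by auto
  obtain c where "c \<noteq> 0" "x = (\<lambda>i. c * y i)" using assms(2) unfolding P hpoint_def by auto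
  then show "P = hpoint x" "\<And>i. i \<notin> {1..d+1} \<Longrightarrow> x i = 0" "\<exists>i. x i \<noteq> 0"
    unfolding P hpoint_eq_iff using y by auto
qed

definition nonvanishing :: "nat \<Rightarrow> ((nat \<Rightarrow> 'k::field) \<Rightarrow> 'k) \<Rightarrow> 'k ppoint set" where
  "nonvanishing d f = {P \<in> PG d. \<forall>x\<in>P. f x \<noteq> 0}"

text \<open>Rescaling multiplies a form by a nonzero power of the scalar, so one representative
  decides.\<close>

lemma hpoint_in_nonvanishing:
  assumes "form d e f" "hpoint x \<in> PG d"
  shows "hpoint x \<in> nonvanishing d f \<longleftrightarrow> f x \<noteq> 0"
proof
  show "hpoint x \<in> nonvanishing d f \<Longrightarrow> f x \<noteq> 0"
    using hpoint_self[of x] unfolding nonvanishing_def by blast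
next
  assume "f x \<noteq> 0"
  then show "hpoint x \<in> nonvanishing d f"
    using assms(2) form_homogeneous[OF assms(1)] by (auto simp: nonvanishing_def hpoint_def)
qed

text \<open>A product of two forms is a form and vanishes exactly where a factor does, so the
  generating sets are closed under intersection: they are a basis, not only a subbasis.\<close>

lemma openin_zariski:
  "openin (zariski d) U \<longleftrightarrow>
     (\<forall>P\<in>U. \<exists>e f. form d e f \<and> P \<in> nonvanishing d f \<and> nonvanishing d f \<subseteq> U)" (is "_ \<longleftrightarrow> ?R U")
proof
  let ?B = "{{P \<in> PG d. \<forall>x\<in>P. f x \<noteq> 0} | f. \<exists>e. form d e f}"
  assume "openin (zariski d) U"
  then have "generate_topology_on ?B U"
    unfolding zariski_def by (rule openin_topology_generated_by)
  then show "?R U"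
  proof induction
    case (Int U V)
    show ?case
    proof
      fix P assume P: "P \<in> U \<inter> V"
      obtain e f where f: "form d e f" "P \<in> nonvanishing d f" "nonvanishing d f \<subseteq> U"
        using Int.IH(1) P by blast
      obtain e' g where g: "form d e' g" "P \<in> nonvanishing d g" "nonvanishing d g \<subseteq> V"
        using Int.IH(2) P by blast
      have "nonvanishing d (\<lambda>x. f x * g x) = nonvanishing d f \<inter> nonvanishing d g"
        unfolding nonvanishing_def by auto
      then show "\<exists>e h. form d e h \<and> P \<in> nonvanishing d h \<and> nonvanishing d h \<subseteq> U \<inter> V"
        using form_mult[OF f(1) g(1)] f g by (metis IntI inf_mono)
    qed
  next
    case (UN K)
    then show ?case by (meson UnionE Union_upper subset_trans)
  next
    case (Basis s)
    then show ?case unfolding nonvanishing_def by auto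
  qed auto
next
  assume R: "?R U"
  have "openin (zariski d) (nonvanishing d f)" if "form d e f" for e and f :: "(nat \<Rightarrow> 'a) \<Rightarrow> 'a"
    unfolding zariski_def nonvanishing_def using that by (intro topology_generated_by_Basis) auto
  then show "openin (zariski d) U"
    using R by (subst openin_subopen) meson
qed

lemma topspace_zariski [simp]: "topspace (zariski d) = PG d"
proof
  show "topspace (zariski d) \<subseteq> PG d" unfolding zariski_def by auto
  have "openin (zariski d) (PG d :: 'a ppoint set)"
    unfolding openin_zariski
    using form_const[of d "1::'a"] by (force simp: nonvanishing_def)
  then show "PG d \<subseteq> topspace (zariski d :: 'a ppoint topology)"
    by (rule openin_subset)
qed

lemma openin_subtopology_zariski:
  assumes "X \<subseteq> PG d"
  shows "openin (subtopology (zariski d) X) U \<longleftrightarrow> U \<subseteq> X \<and>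
     (\<forall>P\<in>U. \<exists>e f. form d e f \<and> P \<in> nonvanishing d f \<and> nonvanishing d f \<inter> X \<subseteq> U)"
    (is "_ \<longleftrightarrow> ?R")
proof
  assume "openin (subtopology (zariski d) X) U"
  then obtain T where T: "openin (zariski d) T" "U = T \<inter> X"
    unfolding openin_subtopology by blast
  then show ?R unfolding openin_zariski by blast
next
  assume R: ?R
  \<comment> \<open>The largest open set of projective space whose trace on \<open>X\<close> lies in
    \<open>U\<close>; the hypothesis makes its trace all of \<open>U\<close>.\<close>
  define T where "T = \<Union>{nonvanishing d f | e f. form d e f \<and> nonvanishing d f \<inter> X \<subseteq> U}"
  have "openin (zariski d) T" unfolding openin_zariski T_def by blast
  moreover have "U = T \<inter> X" using R unfolding T_def by blast
  ultimately show "openin (subtopology (zariski d) X) U"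
    unfolding openin_subtopology by blast
qed

text \<open>For two different points some 2x2 minor of their coordinate vectors is nonzero; freezing
  the vector of \<open>Q\<close> in it gives a linear form that vanishes at \<open>Q\<close> but not
  at \<open>x\<close>. The form wanted is the product of these over \<open>S\<close>.\<close>

lemma form_separating_points:
  assumes "finite S" "S \<subseteq> PG d" "hpoint x \<in> PG d" "hpoint x \<notin> S"
  shows "\<exists>e g. form d e g \<and> g x \<noteq> 0 \<and> (\<forall>Q\<in>S. \<forall>y\<in>Q. g y = 0)"
  using assms(1,2,4)
proof (induction S)
  case empty
  show ?case using form_const[of d "1"] by (intro exI[of _ 0] exI[of _ "\<lambda>_. 1"]) auto
next
  case (insert Q S)
  then obtain e g where g: "form d e g" "g x \<noteq> 0" "\<forall>Q\<in>S. \<forall>y\<in>Q. g y = 0" by auto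
  have "Q \<in> PG d" using insert.prems by auto
  then obtain y where Q: "Q = hpoint y" and y: "\<forall>i. i \<notin> {1..d+1} \<longrightarrow> y i = 0" "\<exists>i. y i \<noteq> 0"
    unfolding PG_def by auto
  obtain k where k: "y k \<noteq> 0" using y by blast
  have "hpoint y \<noteq> hpoint x" using insert.prems Q by auto
  have x0: "\<exists>i. x i \<noteq> 0" and xs: "\<And>i. i \<notin> {1..d+1} \<Longrightarrow> x i = 0"
    using PG_E[OF assms(3) hpoint_self] by auto
  \<comment> \<open>Minors that contain a column \<open>k\<close> with \<open>y k \<noteq> 0\<close>
    suffice: if all of them vanish, then \<open>x\<close> is the multiple \<open>x k / y k\<close>
    of \<open>y\<close>.\<close>
  have "\<exists>i. x i * y k - x k * y i \<noteq> 0"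
  proof (rule ccontr)
    assume "\<nexists>i. x i * y k - x k * y i \<noteq> 0"
    then have eq: "x i = (x k / y k) * y i" for i using k by (simp add: field_simps)
    then have "x k / y k \<noteq> 0" using x0 by (metis mult_zero_left)
    with eq have "hpoint y = hpoint x" unfolding hpoint_eq_iff by blast
    with \<open>hpoint y \<noteq> hpoint x\<close> show False ..
  qed
  then obtain i where i: "x i * y k - x k * y i \<noteq> 0" by blast
  \<comment> \<open>Outside the coordinate range both vectors are zero, and so would be the
    minor.\<close>
  have ik: "k \<in> {1..d+1}" "i \<in> {1..d+1}" using k y i xs by fastforce+
  let ?L = "\<lambda>z. y k * z i + (- y i) * z k"
  have "form d (e + 1) (\<lambda>z. g z * ?L z)"
    by (intro form_mult g form_add form_smult form_coord ik)
  moreover have "g x * ?L x \<noteq> 0" using g(2) i by (simp add: mult.commute)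
  moreover have "g z * ?L z = 0" if "z \<in> R" "R \<in> insert Q S" for R z
    using that g(3) unfolding Q hpoint_def by (auto simp: mult.left_commute)
  ultimately show ?case by blast
qed

section \<open>Vanishing power sums\<close>

text \<open>Comparing coefficients in \<open>f = (X - u) * q\<close> gives the Horner step
  \<open>coeff q k = coeff f (k + 1) + u * coeff q (k + 1)\<close>; this is \<open>N\<close> of them
  in a row. Once \<open>k + N\<close> exceeds the degree of \<open>q\<close>, only coefficients of
  \<open>f\<close> remain.\<close>

lemma coeff_cofactor_linear:
  fixes q :: "'k::comm_ring_1 poly"
  assumes "f = [:- u, 1:] * q"
  shows "coeff q k = (\<Sum>s<N. coeff f (k + 1 + s) * u ^ s) + u ^ N * coeff q (k + N)"
proof (induction N)
  case (Suc N)
  have "coeff f (k + 1 + N) = coeff q (k + N) - u * coeff q (k + Suc N)"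
    unfolding assms by (simp add: mult_pCons_left)
  then have "coeff q (k + N) = coeff f (k + 1 + N) + u * coeff q (k + Suc N)" by simp
  then show ?case using Suc by (simp add: algebra_simps)
qed simp

text \<open>
  Newton's identities, obtained by comparing the coefficients of \<open>f' = (\<Sum>i. f / (X - x i))\<close>
  for \<open>f = (\<Prod>i. X - x i)\<close>.
\<close>

lemma prod_linear_if_power_sums_eq_0:
  fixes x :: "'i \<Rightarrow> 'k::field"
  assumes fin: "finite I" and m: "card I = m" "2 \<le> m"
    and char: "\<And>n. 0 < n \<Longrightarrow> n \<le> m \<Longrightarrow> (of_nat n :: 'k) \<noteq> 0"
    and ps: "\<And>k. 1 \<le> k \<Longrightarrow> k \<le> m - 2 \<Longrightarrow> (\<Sum>i\<in>I. x i ^ k) = 0"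
  shows "\<exists>a b. (\<Prod>i\<in>I. [:- x i, 1:]) = [:0, 1:] ^ m + [:b, a:] \<and>
               (\<Sum>i\<in>I. x i ^ (m - 1)) = - of_nat (m - 1) * a"
proof -
  define f where "f = (\<Prod>i\<in>I. [:- x i, 1:])"
  define q where "q i = (\<Prod>i\<in>I - {i}. [:- x i, 1:])" for i
  have f_q: "f = [:- x i, 1:] * q i" if "i \<in> I" for i
    unfolding f_def q_def using fin that by (rule prod.remove)
  have deg_f: "degree f = m"
    unfolding f_def by (subst degree_prod_eq_sum_degree) (simp_all add: m)
  have lead_f: "coeff f m = 1"
    using lead_coeff_prod[of "\<lambda>i. [:- x i, 1:]" I] deg_f unfolding f_def by simp
  have q_nz: "q i \<noteq> 0" for i
    unfolding q_def using fin by simp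
  have deg_q: "degree (q i) = m - 1" if "i \<in> I" for i
    using fin m that unfolding q_def by (subst degree_prod_eq_sum_degree) simp_all
  have "pderiv [:- x i, 1:] = 1" for i by (simp add: pderiv_pCons)
  then have deriv: "pderiv f = (\<Sum>i\<in>I. q i)"
    unfolding f_def q_def pderiv_prod by simp
  \<comment> \<open>After \<open>m - k\<close> Horner steps the remainder involves coefficient
    \<open>m\<close>, beyond the degree \<open>m - 1\<close> of the cofactor.\<close>
  have coeff_q: "coeff (q i) k = (\<Sum>s<m-k. coeff f (k + 1 + s) * x i ^ s)" if "i \<in> I" "k < m" for i k
  proof -
    have "coeff (q i) (k + (m - k)) = 0"
      using deg_q[OF that(1)] m(2) that(2) by (intro coeff_eq_0) simp
    then show ?thesis using coeff_cofactor_linear[OF f_q[OF that(1)], of k "m - k"] by simp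
  qed
  have newton: "of_nat (Suc k) * coeff f (Suc k) =
      (\<Sum>s<m-k. coeff f (k + 1 + s) * (\<Sum>i\<in>I. x i ^ s))" if "k < m" for k
  proof -
    have "of_nat (Suc k) * coeff f (Suc k) = (\<Sum>i\<in>I. coeff (q i) k)"
      using arg_cong[OF deriv, of "\<lambda>p. coeff p k"] by (simp add: coeff_pderiv coeff_sum)
    also have "\<dots> = (\<Sum>i\<in>I. \<Sum>s<m-k. coeff f (k + 1 + s) * x i ^ s)"
      using coeff_q that by (intro sum.cong) auto
    also have "\<dots> = (\<Sum>s<m-k. coeff f (k + 1 + s) * (\<Sum>i\<in>I. x i ^ s))"
      by (subst sum.swap) (simp add: sum_distrib_left)
    finally show ?thesis .
  qed
  \<comment> \<open>For these \<open>k\<close> all exponents \<open>s\<close> are at most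
    \<open>m - 2\<close>, so only \<open>s = 0\<close> contributes, with power sum \<open>m\<close>.
    The identity reduces to \<open>(m - 1 - k) * coeff f (k + 1) = 0\<close>, and the first factor
    is invertible.\<close>
  have mid: "coeff f (Suc k) = 0" if k: "1 \<le> k" "k \<le> m - 2" for k
  proof -
    have "(\<Sum>s<m-k. coeff f (k + 1 + s) * (\<Sum>i\<in>I. x i ^ s)) =
        (\<Sum>s\<in>{0}. coeff f (k + 1 + s) * (\<Sum>i\<in>I. x i ^ s))"
      using k m(2) by (intro sum.mono_neutral_right) (auto simp: ps)
    then have "of_nat (Suc k) * coeff f (Suc k) = of_nat m * coeff f (Suc k)"
      using newton[of k] k m by (simp add: mult.commute)
    moreover have "(of_nat m :: 'k) = of_nat (Suc k) + of_nat (m - 1 - k)"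
      using k m(2) by (subst of_nat_add[symmetric]) simp
    ultimately have "of_nat (m - 1 - k) * coeff f (Suc k) = 0" by (simp add: algebra_simps)
    then show ?thesis using char[of "m - 1 - k"] k m(2) by simp
  qed
  \<comment> \<open>For \<open>k = 0\<close> the term \<open>s = m - 1\<close> survives too, with
    the leading coefficient 1; it ties the power sum of exponent \<open>m - 1\<close> to the linear
    coefficient.\<close>
  have "(\<Sum>s<m. coeff f (1 + s) * (\<Sum>i\<in>I. x i ^ s)) =
      (\<Sum>s\<in>{0, m - 1}. coeff f (1 + s) * (\<Sum>i\<in>I. x i ^ s))"
    using m(2) ps by (intro sum.mono_neutral_right) auto
  then have "coeff f 1 = of_nat m * coeff f 1 + (\<Sum>i\<in>I. x i ^ (m - 1))"
    using newton[of 0] m lead_f by (simp add: mult.commute)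
  then have "(\<Sum>i\<in>I. x i ^ (m - 1)) = - of_nat (m - 1) * coeff f 1"
    using m(2) by (simp add: of_nat_diff algebra_simps)
  moreover have "f = [:0, 1:] ^ m + [:coeff f 0, coeff f 1:]"
  proof (rule poly_eqI)
    fix n
    have X: "coeff ([:0, 1:] ^ m :: 'k poly) n = (if n = m then 1 else 0)"
      by (metis coeff_monom monom_altdef smult_1_left)
    consider "n = 0" | "n = 1" | "2 \<le> n" "n \<le> m - 1" | "n = m" | "n > m" by linarith
    then show "coeff f n = coeff ([:0, 1:] ^ m + [:coeff f 0, coeff f 1:]) n"
    proof cases
      case 3
      then show ?thesis using mid[of "n - 1"] X
        by (cases n; cases "n - 1") (auto simp: coeff_pCons)
    next
      case 4
      then show ?thesis using lead_f X m(2)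
        by (cases n; cases "n - 1") (auto simp: coeff_pCons)
    next
      case 5
      then show ?thesis using X m(2) deg_f
        by (cases n; cases "n - 1") (auto simp: coeff_pCons coeff_eq_0)
    qed (use X m(2) in auto)
  qed
  ultimately show ?thesis unfolding f_def by blast
qed

text \<open>
  The trinomial is determined by any two of its roots \<open>x i\<close> and \<open>x k\<close>, even if these coincide:
  evaluate \<open>f / (X - x i)\<close> at \<open>x k\<close>.
\<close>

lemma trinomial_coeffs_from_two_roots:
  fixes x :: "'i \<Rightarrow> 'k::field"
  assumes fin: "finite I" and eq: "(\<Prod>i\<in>I. [:- x i, 1:]) = [:0, 1:] ^ m + [:b, a:]"
    and ik: "i \<in> I" "k \<in> I" "i \<noteq> k"
  shows "a = - (\<Sum>s<m. x i ^ (m - Suc s) * x k ^ s)"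
    and "x i ^ m = - a * x i - b"
proof -
  define q where "q = (\<Prod>t\<in>I - {i}. [:- x t, 1:])"
  have f: "[:0, 1:] ^ m + [:b, a:] = [:- x i, 1:] * q"
    unfolding eq[symmetric] q_def using fin ik(1) by (rule prod.remove)
  have root: "x i ^ m + (b + x i * a) = 0"
    using arg_cong[OF f, of "\<lambda>p. poly p (x i)"] by simp
  then show "x i ^ m = - a * x i - b" by (simp add: algebra_simps eq_neg_iff_add_eq_0)
  \<comment> \<open>Adding and subtracting \<open>x i ^ m\<close> splits the trinomial into two
    parts divisible by \<open>X - x i\<close>: a difference of m-th powers, and
    \<open>a * (X - x i)\<close> because \<open>x i\<close> is a root. This makes the cofactor
    explicit.\<close>
  have "[:- x i, 1:] * q = [:0, 1:] ^ m - [:x i:] ^ m + ([:x i ^ m:] + [:b, a:])"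
    unfolding f[symmetric] by (simp add: poly_const_pow)
  also have "[:x i ^ m:] + [:b, a:] = [:- x i, 1:] * [:a:]"
    using root by (simp add: algebra_simps eq_neg_iff_add_eq_0)
  also have "[:0, 1:] ^ m - [:x i:] ^ m = [:- x i, 1:] * (\<Sum>s<m. [:x i:] ^ (m - Suc s) * [:0, 1:] ^ s)"
    by (subst power_diff_sumr2) simp
  finally have "[:- x i, 1:] * q =
      [:- x i, 1:] * ((\<Sum>s<m. [:x i:] ^ (m - Suc s) * [:0, 1:] ^ s) + [:a:])"
    by (simp only: distrib_left)
  then have q: "q = (\<Sum>s<m. [:x i:] ^ (m - Suc s) * [:0, 1:] ^ s) + [:a:]"
    by (subst (asm) mult_left_cancel) simp
  have "poly q (x k) = 0"
    unfolding q_def poly_prod using fin ik by (intro prod_zero) auto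
  then show "a = - (\<Sum>s<m. x i ^ (m - Suc s) * x k ^ s)"
    unfolding q by (simp add: poly_sum eq_neg_iff_add_eq_0 add.commute)
qed

section \<open>Averages of forms over the stabilizer\<close>

text \<open>\<open>char\<close> makes the factorial of \<open>m\<close> invertible, which covers
  characteristic 0 and characteristic \<open>p > m\<close> alike. The argument \<open>K\<close> pins
  down the field type.\<close>

locale projected_curve =
  fixes m l :: nat and j :: "nat \<Rightarrow> nat" and K :: "'k::field itself"
  assumes l_ge: "2 \<le> l" and l_le: "l \<le> m - 1"
    and inj_j: "inj_on j {1..l}" and j_range: "j ` {1..l} \<subseteq> {1..m}"
    and char: "\<And>n. 0 < n \<Longrightarrow> n \<le> m \<Longrightarrow> (of_nat n :: 'k) \<noteq> 0"
begin

text \<open>The affine cone over \<open>V\<close> without its apex: its elements are the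
  representatives of the points of \<open>V\<close>, and forms can be evaluated on them
  directly.\<close>

definition cone :: "(nat \<Rightarrow> 'k) set" where
  "cone = {x. (\<forall>i. i \<notin> {1..m} \<longrightarrow> x i = 0) \<and> (\<exists>i. x i \<noteq> 0) \<and>
              (\<forall>k\<in>{1..m-2}. (\<Sum>i=1..m. x i ^ k) = 0)}"

definition free_indices :: "nat set" where
  "free_indices = {1..m} - j ` {1..l}"

definition stab :: "(nat \<Rightarrow> nat) set" where
  "stab = {h. h permutes free_indices}"

definition proj :: "(nat \<Rightarrow> 'k) \<Rightarrow> nat \<Rightarrow> 'k" where
  "proj x = (\<lambda>s. if s \<in> {1..l} then x (j s) else 0)"

text \<open>Agreement is asked on the cone only, which is where the equations of \<open>V\<close>
  enter. The degree is recorded because the numerator and denominator of a regular function must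
  have the same one.\<close>

definition descends :: "nat \<Rightarrow> ((nat \<Rightarrow> 'k) \<Rightarrow> 'k) \<Rightarrow> bool" where
  "descends e F \<longleftrightarrow> (\<exists>g. form (l-1) e g \<and> (\<forall>x\<in>cone. F x = g (proj x)))"

lemma m_ge: "3 \<le> m"
  using l_ge l_le by simp

lemma j_in: "s \<in> {1..l} \<Longrightarrow> j s \<in> {1..m}"
  using j_range by blast

lemma finite_free_indices [simp]: "finite free_indices"
  unfolding free_indices_def by simp

lemma finite_stab: "finite stab"
  unfolding stab_def by (rule finite_permutations) simp

section \<open>Closure properties of functions that descend\<close>

lemma descends_cong: "descends e F \<Longrightarrow> (\<And>x. x \<in> cone \<Longrightarrow> F x = G x) \<Longrightarrow> descends e G"
  unfolding descends_def by fastforce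

lemma descends_const: "descends 0 (\<lambda>x. r)"
  unfolding descends_def using form_const[of "l-1" r] by blast

lemma descends_zero: "descends e (\<lambda>x. 0)"
  unfolding descends_def using form_zero[of "l-1" e] by blast

lemma descends_coord:
  assumes "s \<in> {1..l}" shows "descends 1 (\<lambda>x. x (j s))"
  using form_coord[of s "l-1", where ?'a = 'k] assms unfolding descends_def proj_def
  by (intro exI[of _ "\<lambda>x. x s"]) auto

lemma descends_smult: "descends e F \<Longrightarrow> descends e (\<lambda>x. r * F x)"
  unfolding descends_def using form_smult by fastforce

lemma descends_add: "descends e F \<Longrightarrow> descends e G \<Longrightarrow> descends e (\<lambda>x. F x + G x)"
  unfolding descends_def using form_add by fastforce

lemma descends_diff: "descends e F \<Longrightarrow> descends e G \<Longrightarrow> descends e (\<lambda>x. F x - G x)"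
  using descends_add[of e F "\<lambda>x. (-1) * G x"] descends_smult[of e G "-1"] by simp

lemma descends_mult: "descends e F \<Longrightarrow> descends e' G \<Longrightarrow> descends (e + e') (\<lambda>x. F x * G x)"
  unfolding descends_def using form_mult by fastforce

lemma descends_sum:
  assumes "\<And>s. s \<in> S \<Longrightarrow> descends e (F s)" shows "descends e (\<lambda>x. \<Sum>s\<in>S. F s x)"
  using assms
proof (induction S rule: infinite_finite_induct)
  case (insert s S)
  then show ?case using descends_add[of e "F s" "\<lambda>x. \<Sum>s\<in>S. F s x"] by simp
qed (auto simp: descends_zero)

lemma descends_prod:
  assumes "\<And>s. s \<in> S \<Longrightarrow> descends (e s) (F s)"
  shows "descends (\<Sum>s\<in>S. e s) (\<lambda>x. \<Prod>s\<in>S. F s x)"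
  using assms
proof (induction S rule: infinite_finite_induct)
  case (insert s S)
  then show ?case using descends_mult[of "e s" "F s" _ "\<lambda>x. \<Prod>s\<in>S. F s x"] by simp
qed (auto simp: descends_const)

lemma descends_coord_power:
  assumes "s \<in> {1..l}" shows "descends n (\<lambda>x. x (j s) ^ n)"
  using descends_prod[of "{..<n}" "\<lambda>_. 1" "\<lambda>_ x. x (j s)"] descends_coord[OF assms] by simp

section \<open>The trinomial attached to a cone vector\<close>

definition coeff1 :: "(nat \<Rightarrow> 'k) \<Rightarrow> 'k" where
  "coeff1 x = - (\<Sum>s<m. x (j 1) ^ (m - Suc s) * x (j 2) ^ s)"

text \<open>On the cone, \<open>T^m + coeff1 x * T + coeff0 x\<close> is the monic polynomial with
  roots \<open>x 1, ..., x m\<close>. Both coefficients are written in \<open>x (j 1)\<close> and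
  \<open>x (j 2)\<close> alone, so that they descend as soon as \<open>l \<ge> 2\<close>.\<close>

definition coeff0 :: "(nat \<Rightarrow> 'k) \<Rightarrow> 'k" where
  "coeff0 x = - coeff1 x * x (j 1) - x (j 1) ^ m"

lemma j12: "j 1 \<noteq> j 2" "j 1 \<in> {1..m}" "j 2 \<in> {1..m}"
  using inj_on_eq_iff[OF inj_j, of 1 2] j_in l_ge by auto

lemma cone_trinomial:
  assumes "x \<in> cone"
  shows "\<And>i. i \<in> {1..m} \<Longrightarrow> x i ^ m = - coeff1 x * x i - coeff0 x"
    and "(\<Sum>i=1..m. x i ^ (m - 1)) = - of_nat (m - 1) * coeff1 x"
proof -
  have "\<exists>a b. (\<Prod>i\<in>{1..m}. [:- x i, 1:]) = [:0, 1:] ^ m + [:b, a:] \<and>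
               (\<Sum>i\<in>{1..m}. x i ^ (m - 1)) = - of_nat (m - 1) * a"
    using assms m_ge char by (intro prod_linear_if_power_sums_eq_0) (auto simp: cone_def)
  then obtain a b where eq: "(\<Prod>i\<in>{1..m}. [:- x i, 1:]) = [:0, 1:] ^ m + [:b, a:]"
    and ps: "(\<Sum>i=1..m. x i ^ (m - 1)) = - of_nat (m - 1) * a" by blast
  note roots = trinomial_coeffs_from_two_roots[OF finite_atLeastAtMost eq]
  have a: "a = coeff1 x"
    using roots(1)[of "j 1" "j 2"] j12 unfolding coeff1_def by simp
  have b: "b = coeff0 x"
    using roots(2)[of "j 1" "j 2"] j12 unfolding coeff0_def a by simp
  show "(\<Sum>i=1..m. x i ^ (m - 1)) = - of_nat (m - 1) * coeff1 x" using ps a by simp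
  show "x i ^ m = - coeff1 x * x i - coeff0 x" if "i \<in> {1..m}" for i
  \<comment> \<open>The two-root formula needs a second index different from
    \<open>i\<close>.\<close>
  proof (cases "i = j 1")
    case True
    then show ?thesis using roots(2)[of i "j 2"] j12 that a b by simp
  next
    case False
    then show ?thesis using roots(2)[of i "j 1"] j12 that a b by simp
  qed
qed

text \<open>If both coordinates vanish, so do both coefficients; the trinomial is then
  \<open>T^m\<close> and every coordinate is zero. Hence the centre of projection misses
  \<open>V\<close> and every point has an image.\<close>

lemma coord_nonzero_of_two:
  assumes "x \<in> cone" shows "x (j 1) \<noteq> 0 \<or> x (j 2) \<noteq> 0"
proof (rule ccontr)
  assume "\<not> ?thesis"
  then have z: "x (j 1) = 0" "x (j 2) = 0" by auto
  \<comment> \<open>The exponents add up to \<open>m - 1 > 0\<close>, so one of them is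
    positive.\<close>
  have "x (j 1) ^ (m - Suc s) * x (j 2) ^ s = 0" if "s \<in> {..<m}" for s
    using z m_ge that by (cases s) auto
  then have "(\<Sum>s<m. x (j 1) ^ (m - Suc s) * x (j 2) ^ s) = 0"
    by (intro sum.neutral ballI)
  then have a: "coeff1 x = 0" unfolding coeff1_def by simp
  then have b: "coeff0 x = 0" unfolding coeff0_def using z m_ge by simp
  have "x i = 0" if "i \<in> {1..m}" for i
    using cone_trinomial(1)[OF assms that] a b by simp
  then have "x i = 0" for i using assms unfolding cone_def by blast
  then show False using assms unfolding cone_def by blast
qed

lemma proj_nonzero: "x \<in> cone \<Longrightarrow> \<exists>s. proj x s \<noteq> 0"
  using coord_nonzero_of_two[of x] l_ge unfolding proj_def
  by (metis One_nat_def Suc_leD atLeastAtMost_iff numeral_2_eq_2 order_refl one_le_numeral)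

lemma descends_coeff1: "descends (m - 1) coeff1"
proof -
  have "descends (m - 1) (\<lambda>x. x (j 1) ^ (m - Suc s) * x (j 2) ^ s)" if "s < m" for s
  proof -
    have "descends (m - Suc s + s) (\<lambda>x. x (j 1) ^ (m - Suc s) * x (j 2) ^ s)"
      using l_ge by (intro descends_mult descends_coord_power) auto
    then show ?thesis using that by simp
  qed
  then have "descends (m - 1) (\<lambda>x. (-1) * (\<Sum>s<m. x (j 1) ^ (m - Suc s) * x (j 2) ^ s))"
    by (intro descends_smult descends_sum) auto
  then show ?thesis unfolding coeff1_def by simp
qed

lemma descends_coeff0: "descends m coeff0"
proof -
  have "descends (m - 1 + 1) (\<lambda>x. coeff1 x * x (j 1))"
    using l_ge by (intro descends_mult descends_coeff1 descends_coord) auto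
  then have "descends m (\<lambda>x. (-1) * (coeff1 x * x (j 1)) - x (j 1) ^ m)"
    using l_ge m_ge by (intro descends_diff descends_smult descends_coord_power) auto
  then show ?thesis unfolding coeff0_def by simp
qed

text \<open>Strong induction, with \<open>p k\<close> for the k-th power sum. On the cone
  \<open>p 1, ..., p (m - 2)\<close> vanish and \<open>p (m - 1)\<close> is a multiple of
  \<open>coeff1\<close>; from there on the trinomial equation, multiplied by \<open>x i ^ n\<close>
  and summed over \<open>i\<close>, gives
  \<open>p (m + n) = - coeff1 * p (n + 1) - coeff0 * p n\<close>.\<close>

lemma descends_power_sum: "descends k (\<lambda>x. \<Sum>i=1..m. x i ^ k)"
proof (induction k rule: less_induct)
  case (less k)
  consider "k = 0" | "1 \<le> k" "k \<le> m - 2" | "k = m - 1" | "k \<ge> m" by linarith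
  then show ?case
  proof cases
    case 1
    then show ?thesis using descends_const[of "of_nat m"] by simp
  next
    case 2
    then show ?thesis
      by (intro descends_cong[OF descends_zero]) (auto simp: cone_def)
  next
    case 3
    show ?thesis unfolding 3
      by (rule descends_cong[OF descends_smult[OF descends_coeff1]]) (simp only: cone_trinomial)
  next
    case 4
    then obtain n where k: "k = m + n" using le_Suc_ex by blast
    have "descends (m - 1 + Suc n) (\<lambda>x. coeff1 x * (\<Sum>i=1..m. x i ^ Suc n))"
      using less[of "Suc n"] k m_ge by (intro descends_mult descends_coeff1) simp
    moreover have "descends (m + n) (\<lambda>x. coeff0 x * (\<Sum>i=1..m. x i ^ n))"
      using less[of n] k m_ge by (intro descends_mult descends_coeff0) simp
    ultimately have "descends k (\<lambda>x. (-1) * (coeff1 x * (\<Sum>i=1..m. x i ^ Suc n))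
        - coeff0 x * (\<Sum>i=1..m. x i ^ n))"
      using k m_ge by (intro descends_diff descends_smult) simp_all
    then show ?thesis
    proof (rule descends_cong)
      fix x assume "x \<in> cone"
      then have "x i ^ k = - coeff1 x * x i ^ Suc n - coeff0 x * x i ^ n" if "i \<in> {1..m}" for i
        by (simp add: k power_add cone_trinomial(1)[OF \<open>x \<in> cone\<close> that] left_diff_distrib mult.assoc)
      then have "(\<Sum>i=1..m. x i ^ k) = (\<Sum>i=1..m. - coeff1 x * x i ^ Suc n - coeff0 x * x i ^ n)"
        by (intro sum.cong) auto
      then show "(-1) * (coeff1 x * (\<Sum>i=1..m. x i ^ Suc n)) - coeff0 x * (\<Sum>i=1..m. x i ^ n)
          = (\<Sum>i=1..m. x i ^ k)"
        by (simp only: sum_subtractf sum_distrib_left[symmetric]) simp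
    qed
  qed
qed

section \<open>From power sums to averages of forms\<close>

lemma descends_power_sum_free: "descends k (\<lambda>x. \<Sum>i\<in>free_indices. x i ^ k)"
proof -
  have "descends k (\<lambda>x. (\<Sum>i=1..m. x i ^ k) - (\<Sum>s\<in>{1..l}. x (j s) ^ k))"
    by (intro descends_diff descends_power_sum descends_sum descends_coord_power)
  moreover have "(\<Sum>i=1..m. x i ^ k) - (\<Sum>s\<in>{1..l}. x (j s) ^ k) = (\<Sum>i\<in>free_indices. x i ^ k)"
    for x :: "nat \<Rightarrow> 'k"
    unfolding free_indices_def using j_range inj_j
    by (simp add: sum_diff sum.reindex o_def)
  ultimately show ?thesis by simp
qed

text \<open>
  Multiplying the average of a monomial in \<open>S\<close> by a power sum expresses the average of a monomial
  in one more variable \<open>r\<close> through averages of monomials in \<open>S\<close>; the indices outside \<open>S\<close>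
  are interchangeable with \<open>r\<close>, which accounts for a factor that is invertible in the field.
\<close>

lemma descends_monomial_average:
  assumes "finite S" "S \<subseteq> free_indices"
  shows "descends (\<Sum>i\<in>S. a i) (\<lambda>x. \<Sum>h\<in>stab. \<Prod>i\<in>S. x (h i) ^ a i)"
  using assms
proof (induction S arbitrary: a)
  case empty
  show ?case using descends_const[of "of_nat (card stab)"] by simp
next
  case (insert r S)
  let ?n = "card (free_indices - S)"
  let ?M = "\<lambda>S a x. \<Sum>h\<in>stab. \<Prod>i\<in>S. x (h i) ^ a i :: 'k"
  have r: "r \<in> free_indices" "r \<notin> S" and S: "S \<subseteq> free_indices" using insert by auto
  \<comment> \<open>Expand the product over the index \<open>t\<close> of the power sum: for
    \<open>t\<close> in \<open>S\<close> the two exponents at \<open>t\<close> merge, and each of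
    the \<open>?n\<close> other \<open>t\<close> gives the average of the larger monomial.\<close>
  have key: "?M S a x * (\<Sum>i\<in>free_indices. x i ^ a r) =
      (\<Sum>t\<in>S. ?M S (a(t := a t + a r)) x) + of_nat ?n * ?M (insert r S) a x" for x
  proof -
    \<comment> \<open>The power sum is symmetric, so it may be reindexed by the same
      \<open>h\<close> as the monomial.\<close>
    have ps: "(\<Sum>i\<in>free_indices. x i ^ a r) = (\<Sum>t\<in>free_indices. x (h t) ^ a r)" if "h \<in> stab" for h
      using sum.permute[of h free_indices "\<lambda>i. x i ^ a r"] that unfolding stab_def by (simp add: o_def)
    have "?M S a x * (\<Sum>i\<in>free_indices. x i ^ a r) =
        (\<Sum>h\<in>stab. (\<Prod>i\<in>S. x (h i) ^ a i) * (\<Sum>i\<in>free_indices. x i ^ a r))"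
      by (rule sum_distrib_right)
    also have "\<dots> = (\<Sum>h\<in>stab. \<Sum>t\<in>free_indices. (\<Prod>i\<in>S. x (h i) ^ a i) * x (h t) ^ a r)"
      by (intro sum.cong refl) (simp add: ps sum_distrib_left)
    also have "\<dots> = (\<Sum>t\<in>free_indices. \<Sum>h\<in>stab. (\<Prod>i\<in>S. x (h i) ^ a i) * x (h t) ^ a r)"
      by (rule sum.swap)
    also have "\<dots> = (\<Sum>t\<in>S. \<Sum>h\<in>stab. (\<Prod>i\<in>S. x (h i) ^ a i) * x (h t) ^ a r) +
        (\<Sum>t\<in>free_indices - S. \<Sum>h\<in>stab. (\<Prod>i\<in>S. x (h i) ^ a i) * x (h t) ^ a r)"
      using S by (simp add: sum.subset_diff)
    also have "(\<Sum>t\<in>S. \<Sum>h\<in>stab. (\<Prod>i\<in>S. x (h i) ^ a i) * x (h t) ^ a r) =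
        (\<Sum>t\<in>S. ?M S (a(t := a t + a r)) x)"
    proof (intro sum.cong refl)
      fix t h assume t: "t \<in> S"
      have "(\<Prod>i\<in>S - {t}. x (h i) ^ (a(t := a t + a r)) i) = (\<Prod>i\<in>S - {t}. x (h i) ^ a i)"
        by (intro prod.cong) auto
      then show "(\<Prod>i\<in>S. x (h i) ^ a i) * x (h t) ^ a r = (\<Prod>i\<in>S. x (h i) ^ (a(t := a t + a r)) i)"
        using prod.remove[OF insert.hyps(1) t, of "\<lambda>i. x (h i) ^ a i"]
          prod.remove[OF insert.hyps(1) t, of "\<lambda>i. x (h i) ^ (a(t := a t + a r)) i"]
        by (simp add: power_add)
    qed
    also have "(\<Sum>t\<in>free_indices - S. \<Sum>h\<in>stab. (\<Prod>i\<in>S. x (h i) ^ a i) * x (h t) ^ a r) =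
        (\<Sum>t\<in>free_indices - S. ?M (insert r S) a x)"
    proof (rule sum.cong[OF refl])
      fix t assume t: "t \<in> free_indices - S"
      \<comment> \<open>This transposition lies in the stabilizer and fixes \<open>S\<close>
        pointwise; replacing \<open>h\<close> by \<open>h \<circ> \<tau>\<close> turns
        \<open>t\<close> into \<open>r\<close> and leaves the rest of the monomial alone.\<close>
      define \<tau> where "\<tau> = Transposition.transpose r t"
      have \<tau>: "\<tau> permutes free_indices"
        unfolding \<tau>_def using r(1) t by (intro permutes_swap_id) auto
      have \<tau>S: "\<tau> i = i" if "i \<in> S" for i
        unfolding \<tau>_def using that r t by (intro transpose_apply_other) auto
      have "(\<Sum>h\<in>stab. (\<Prod>i\<in>S. x (h i) ^ a i) * x (h t) ^ a r) =
          (\<Sum>h\<in>stab. (\<Prod>i\<in>S. x ((h \<circ> \<tau>) i) ^ a i) * x ((h \<circ> \<tau>) t) ^ a r)"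
        unfolding stab_def by (rule sum_permutations_compose_right[OF \<tau>])
      also have "\<dots> = (\<Sum>h\<in>stab. (\<Prod>i\<in>S. x (h i) ^ a i) * x (h r) ^ a r)"
        using \<tau>S by (simp add: \<tau>_def)
      also have "\<dots> = ?M (insert r S) a x"
        using insert.hyps by (simp add: mult.commute)
      finally show "(\<Sum>h\<in>stab. (\<Prod>i\<in>S. x (h i) ^ a i) * x (h t) ^ a r) = ?M (insert r S) a x" .
    qed
    finally show ?thesis by simp
  qed
  have deg: "(\<Sum>i\<in>S. (a(t := a t + a r)) i) = (\<Sum>i\<in>insert r S. a i)" if t: "t \<in> S" for t
  proof -
    have "(\<Sum>i\<in>S - {t}. (a(t := a t + a r)) i) = (\<Sum>i\<in>S - {t}. a i)"
      by (intro sum.cong) auto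
    then show ?thesis
      using sum.remove[OF insert.hyps(1) t, of a] insert.hyps
        sum.remove[OF insert.hyps(1) t, of "a(t := a t + a r)"]
      by simp
  qed
  have "descends (\<Sum>i\<in>insert r S. a i) (\<lambda>x. inverse (of_nat ?n) *
      (?M S a x * (\<Sum>i\<in>free_indices. x i ^ a r) - (\<Sum>t\<in>S. ?M S (a(t := a t + a r)) x)))"
  proof (intro descends_smult descends_diff descends_sum[of S])
    show "descends (\<Sum>i\<in>insert r S. a i) (\<lambda>x. ?M S a x * (\<Sum>i\<in>free_indices. x i ^ a r))"
      using descends_mult[OF insert.IH[OF S] descends_power_sum_free] insert.hyps
      by (simp add: add.commute)
    show "descends (\<Sum>i\<in>insert r S. a i) (?M S (a(t := a t + a r)))" if "t \<in> S" for t
      using insert.IH[OF S, of "a(t := a t + a r)"] deg[OF that] by simp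
  qed
  moreover have "(of_nat ?n :: 'k) \<noteq> 0"
  proof (rule char)
    show "0 < ?n" using r by (auto simp: card_gt_0_iff)
    have "?n \<le> card {1..m}" by (rule card_mono) (auto simp: free_indices_def)
    then show "?n \<le> m" by simp
  qed
  ultimately show ?case unfolding key by (simp add: mult.assoc[symmetric])
qed

lemma stab_fixes: "h \<in> stab \<Longrightarrow> s \<in> {1..l} \<Longrightarrow> h (j s) = j s"
  unfolding stab_def free_indices_def by (auto intro: permutes_not_in)

text \<open>By linearity a monomial suffices. Its part in the projected indices is fixed by the
  stabilizer and comes out of the sum; what remains is the average of a monomial in the free
  indices.\<close>

lemma descends_average:
  assumes "form (m-1) e f" shows "descends e (\<lambda>x. \<Sum>h\<in>stab. f (x \<circ> h))"
proof -
  have m: "m - 1 + 1 = m" using m_ge by simp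
  obtain A c where A: "\<And>a. a \<in> A \<Longrightarrow> (\<Sum>i=1..m. a i) = e"
    and f: "f = (\<lambda>x. \<Sum>a\<in>A. c a * (\<Prod>i=1..m. x i ^ a i))"
    using assms unfolding form_def m by blast
  have "descends e (\<lambda>x. \<Sum>h\<in>stab. \<Prod>i=1..m. x (h i) ^ a i)" if a: "a \<in> A" for a
  proof -
    have split: "{1..m} = j ` {1..l} \<union> free_indices" "j ` {1..l} \<inter> free_indices = {}"
      using j_range unfolding free_indices_def by auto
    have "descends ((\<Sum>s\<in>{1..l}. a (j s)) + (\<Sum>i\<in>free_indices. a i))
        (\<lambda>x. (\<Prod>s\<in>{1..l}. x (j s) ^ a (j s)) * (\<Sum>h\<in>stab. \<Prod>i\<in>free_indices. x (h i) ^ a i))"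
      by (intro descends_mult descends_prod descends_coord_power descends_monomial_average) auto
    moreover have "(\<Sum>s\<in>{1..l}. a (j s)) + (\<Sum>i\<in>free_indices. a i) = e"
      using A[OF a] inj_j unfolding split(1)
      by (subst (asm) sum.union_disjoint) (use split(2) in \<open>auto simp: sum.reindex\<close>)
    moreover have "(\<Prod>i=1..m. x (h i) ^ a i) =
        (\<Prod>s\<in>{1..l}. x (j s) ^ a (j s)) * (\<Prod>i\<in>free_indices. x (h i) ^ a i)" if "h \<in> stab"
      for x :: "nat \<Rightarrow> 'k" and h
      unfolding split(1) using inj_j stab_fixes[OF that]
      by (subst prod.union_disjoint) (use split(2) in \<open>auto simp: prod.reindex\<close>)
    ultimately show ?thesis by (simp add: sum_distrib_left)
  qed
  then have "descends e (\<lambda>x. \<Sum>a\<in>A. c a * (\<Sum>h\<in>stab. \<Prod>i=1..m. x (h i) ^ a i))"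
    by (intro descends_sum[of A] descends_smult)
  moreover have "(\<Sum>a\<in>A. c a * (\<Sum>h\<in>stab. \<Prod>i=1..m. x (h i) ^ a i)) = (\<Sum>h\<in>stab. f (x \<circ> h))" for x
    unfolding f sum_distrib_left by (subst sum.swap) simp
  ultimately show ?thesis by simp
qed

end

section \<open>The projection as a quotient map\<close>

lemma openin_nonvanishing:
  assumes "X \<subseteq> PG d" "form d e f"
  shows "openin (subtopology (zariski d) X) (nonvanishing d f \<inter> X)"
  unfolding openin_subtopology_zariski[OF assms(1)] using assms(2) by blast

lemma regular_variety:
  "f \<in> regular (variety d X) U \<longleftrightarrow>
     (\<forall>P\<in>U. \<exists>W e a b. openin (subtopology (zariski d) X) W \<and> P \<in> W \<and> W \<subseteq> U \<and>
        form d e a \<and> form d e b \<and> (\<forall>Q\<in>W. \<forall>x\<in>Q. b x \<noteq> 0 \<and> f Q = a x / b x))"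
  unfolding variety_def by simp

context projected_curve
begin

abbreviation V :: "'k ppoint set" where "V \<equiv> curveV m"
abbreviation V_proj :: "'k ppoint set" where "V_proj \<equiv> project l j ` V"
abbreviation "group_H \<equiv> coord_stabilizer m l j"
abbreviation "V_top \<equiv> subtopology (zariski (m - 1)) V"
abbreviation "V_proj_top \<equiv> subtopology (zariski (l - 1)) V_proj"

section \<open>The action of the stabilizer on the cone\<close>

lemma id_in_stab: "id \<in> stab"
  unfolding stab_def by (simp add: permutes_id)

lemma comp_in_stab: "h \<in> stab \<Longrightarrow> h' \<in> stab \<Longrightarrow> h \<circ> h' \<in> stab"
  unfolding stab_def by (simp add: permutes_compose)

lemma inv_in_stab: "h \<in> stab \<Longrightarrow> inv' h \<in> stab"
  unfolding stab_def by (simp add: permutes_inv)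

lemma stab_inverses: "h \<in> stab \<Longrightarrow> h \<circ> inv' h = id" "h \<in> stab \<Longrightarrow> inv' h \<circ> h = id"
  unfolding stab_def by (auto intro: permutes_inv_o)

lemma stab_permutes: "h \<in> stab \<Longrightarrow> h permutes {1..m}"
  unfolding stab_def free_indices_def by (auto intro: permutes_subset)

lemma carrier_coord_stabilizer: "carrier group_H = stab"
proof -
  have "p \<in> stab" if "p permutes {1..m}" "\<forall>s\<in>{1..l}. p (j s) = j s" for p
    unfolding stab_def using that by (auto simp: free_indices_def intro: permutes_superset)
  then show ?thesis
    unfolding coord_stabilizer_def sym_group_def using stab_permutes stab_fixes by auto
qed

lemma cone_comp:
  assumes "x \<in> cone" "h \<in> stab" shows "x \<circ> h \<in> cone"
proof -
  note h = stab_permutes[OF assms(2)]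
  have "(x \<circ> h) i = 0" if "i \<notin> {1..m}" for i
    using assms(1) permutes_not_in[OF h that] that unfolding cone_def by auto
  moreover have "\<exists>i. (x \<circ> h) i \<noteq> 0"
  proof -
    obtain i where "x i \<noteq> 0" using assms(1) unfolding cone_def by blast
    then have "(x \<circ> h) (inv' h i) \<noteq> 0" by (simp add: permutes_inverses(1)[OF h])
    then show ?thesis ..
  qed
  moreover have "(\<Sum>i=1..m. (x \<circ> h) i ^ k) = (\<Sum>i=1..m. x i ^ k)" for k
    using sum.permute[OF h, of "\<lambda>i. x i ^ k"] by (simp add: o_def)
  ultimately show ?thesis using assms(1) unfolding cone_def by auto
qed

lemma cone_scale:
  assumes "x \<in> cone" "c \<noteq> 0" shows "(\<lambda>i. c * x i) \<in> cone"
  using assms unfolding cone_def by (auto simp: power_mult_distrib sum_distrib_left[symmetric])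

lemma proj_comp: "h \<in> stab \<Longrightarrow> proj (x \<circ> h) = proj x"
  unfolding proj_def using stab_fixes by fastforce

lemma proj_scale: "proj (\<lambda>i. c * x i) = (\<lambda>s. c * proj x s)"
  unfolding proj_def by auto

section \<open>The curve and its image in terms of cone vectors\<close>

lemma V_eq: "V = hpoint ` cone"
proof -
  have m: "m - 1 + 1 = m" using m_ge by simp
  have "hpoint x \<in> V" if "x \<in> cone" for x
  proof -
    have "y \<in> cone" if "y \<in> hpoint x" for y
      using that cone_scale[OF \<open>x \<in> cone\<close>] unfolding hpoint_def by auto
    moreover have "hpoint x \<in> PG (m - 1)"
      using that unfolding PG_def m cone_def by auto
    ultimately show ?thesis unfolding curveV_def cone_def by blast
  qed
  moreover have "P \<in> hpoint ` cone" if "P \<in> V" for P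
  proof -
    have P: "P \<in> PG (m - 1)" "\<forall>x\<in>P. \<forall>k\<in>{1..m-2}. (\<Sum>i=1..m. x i ^ k) = 0"
      using that unfolding curveV_def by auto
    obtain x where x: "P = hpoint x" "\<forall>i. i \<notin> {1..m} \<longrightarrow> x i = 0" "\<exists>i. x i \<noteq> 0"
      using P(1) unfolding PG_def m by blast
    then have "x \<in> cone" using P(2) hpoint_self[of x] unfolding cone_def by blast
    then show ?thesis using x(1) by blast
  qed
  ultimately show ?thesis by blast
qed

lemma hpoint_in_V: "x \<in> cone \<Longrightarrow> hpoint x \<in> V"
  unfolding V_eq by blast

lemma V_E:
  assumes "P \<in> V" "x \<in> P" shows "x \<in> cone" "P = hpoint x"
proof -
  obtain y where y: "y \<in> cone" "P = hpoint y" using assms(1) unfolding V_eq by blast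
  then obtain c where c: "c \<noteq> 0" "x = (\<lambda>i. c * y i)" using assms(2) unfolding hpoint_def by blast
  then show "x \<in> cone" using cone_scale y by simp
  show "P = hpoint x" unfolding y hpoint_eq_iff using c by blast
qed

lemma V_subset: "V \<subseteq> PG (m - 1)"
  unfolding curveV_def by blast

lemma project_hpoint: "project l j (hpoint x) = hpoint (proj x)"
proof -
  have multiples: "hpoint y = (\<lambda>c i. c * y i) ` {c. c \<noteq> 0}" for y :: "nat \<Rightarrow> 'k"
    unfolding hpoint_def by blast
  have "project l j (hpoint x) = proj ` hpoint x"
    unfolding project_def proj_def ..
  also have "\<dots> = hpoint (proj x)"
    unfolding multiples by (simp add: image_image proj_scale)
  finally show ?thesis .
qed

lemma V_proj_eq: "V_proj = (\<lambda>x. hpoint (proj x)) ` cone"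
  unfolding V_eq image_image project_hpoint ..

lemma V_proj_subset: "V_proj \<subseteq> PG (l - 1)"
proof -
  have l: "l - 1 + 1 = l" using l_ge by simp
  have "hpoint (proj x) \<in> PG (l - 1)" if "x \<in> cone" for x
    using proj_nonzero[OF that] unfolding PG_def l by (auto simp: proj_def)
  then show ?thesis unfolding V_proj_eq by blast
qed

text \<open>Projection commutes with scaling, so each representative of an image point is the
  projection of a cone vector. This is needed because regularity quantifies over all
  representatives.\<close>

lemma V_proj_E:
  assumes "Q \<in> V_proj" "z \<in> Q"
  obtains y where "y \<in> cone" "z = proj y" "Q = hpoint (proj y)"
proof -
  obtain x where x: "x \<in> cone" "Q = hpoint (proj x)" using assms(1) unfolding V_proj_eq by blast
  then obtain c where c: "c \<noteq> 0" "z = (\<lambda>s. c * proj x s)"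
    using assms(2) unfolding hpoint_def by blast
  have "hpoint (proj x) = hpoint (proj (\<lambda>i. c * x i))"
    unfolding hpoint_eq_iff proj_scale using c(1) by blast
  then show ?thesis using that[of "\<lambda>i. c * x i"] cone_scale[OF x(1) c(1)] x c by (simp add: proj_scale)
qed

section \<open>Orbits and forms that separate them\<close>

lemma orbit_hpoint: "orbit group_H permute_coords (hpoint x) = (\<lambda>h. hpoint (x \<circ> h)) ` stab"
proof -
  \<comment> \<open>The inverse in the action disappears in the orbit, as the stabilizer is closed
    under inverses.\<close>
  have act: "permute_coords p (hpoint x) = hpoint (x \<circ> inv' p)" for p
    unfolding permute_coords_def hpoint_def by (auto simp: o_def image_iff)
  have "hpoint (x \<circ> h) \<in> orbit group_H permute_coords (hpoint x)" if h: "h \<in> stab" for h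
  proof -
    have "inv' (inv' h) = h" using h unfolding stab_def by (auto intro: permutes_inv_inv)
    then have "hpoint (x \<circ> h) = permute_coords (inv' h) (hpoint x)" unfolding act by simp
    then show ?thesis
      using inv_in_stab[OF h] unfolding orbit_def carrier_coord_stabilizer by blast
  qed
  moreover have "P \<in> (\<lambda>h. hpoint (x \<circ> h)) ` stab" if "P \<in> orbit group_H permute_coords (hpoint x)" for P
    using that inv_in_stab unfolding orbit_def carrier_coord_stabilizer by (auto simp: act)
  ultimately show ?thesis by blast
qed

text \<open>The permutations fixing \<open>x\<close> form a subgroup, so their number divides the
  order of the stabilizer. That order is the factorial of a number at most \<open>m\<close>, hence
  invertible.\<close>

lemma card_stab_fixing_nonzero: "(of_nat (card {h \<in> stab. x \<circ> h = x}) :: 'k) \<noteq> 0"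
proof -
  let ?F = "{h \<in> stab. x \<circ> h = x}"
  \<comment> \<open>Right translation by \<open>h0\<close> carries the fibre of
    \<open>h \<mapsto> x \<circ> h\<close> over \<open>x\<close> to the one over
    \<open>x \<circ> h0\<close>, so all fibres have the same size.\<close>
  have fibre: "card {h \<in> stab. x \<circ> h = x \<circ> h0} = card ?F" if h0: "h0 \<in> stab" for h0
  proof -
    have "bij_betw (\<lambda>h. h \<circ> h0) ?F {h \<in> stab. x \<circ> h = x \<circ> h0}"
    proof (rule bij_betw_byWitness[where f' = "\<lambda>h. h \<circ> inv' h0"])
      show "\<forall>h\<in>?F. h \<circ> h0 \<circ> inv' h0 = h" "\<forall>h\<in>{h \<in> stab. x \<circ> h = x \<circ> h0}. h \<circ> inv' h0 \<circ> h0 = h"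
        using stab_inverses[OF h0] by (simp_all add: comp_assoc)
      show "(\<lambda>h. h \<circ> h0) ` ?F \<subseteq> {h \<in> stab. x \<circ> h = x \<circ> h0}"
        using comp_in_stab h0 by (auto simp: comp_assoc[symmetric])
      have "x \<circ> (h \<circ> inv' h0) = x" if "x \<circ> h = x \<circ> h0" for h
        using that stab_inverses(1)[OF h0] by (metis comp_assoc comp_id)
      then show "(\<lambda>h. h \<circ> inv' h0) ` {h \<in> stab. x \<circ> h = x \<circ> h0} \<subseteq> ?F"
        using comp_in_stab inv_in_stab[OF h0] by auto
    qed
    then show ?thesis by (rule bij_betw_same_card[symmetric])
  qed
  have "card stab = (\<Sum>v\<in>(\<lambda>h. x \<circ> h) ` stab. card {h \<in> stab. x \<circ> h = v})"
    using sum.image_gen[OF finite_stab, of "\<lambda>_. 1::nat" "\<lambda>h. x \<circ> h"] by simp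
  also have "\<dots> = (\<Sum>v\<in>(\<lambda>h. x \<circ> h) ` stab. card ?F)"
    using fibre by (intro sum.cong refl) blast
  also have "\<dots> = card ((\<lambda>h. x \<circ> h) ` stab) * card ?F"
    by simp
  finally have "(of_nat (card stab) :: 'k) = of_nat (card ((\<lambda>h. x \<circ> h) ` stab)) * of_nat (card ?F)"
    by (simp only: of_nat_mult)
  moreover have "(of_nat (card stab) :: 'k) \<noteq> 0"
  proof -
    have nz: "n \<le> m \<Longrightarrow> (of_nat (fact n) :: 'k) \<noteq> 0" for n
    proof (induction n)
      case (Suc n)
      have "(of_nat (fact (Suc n)) :: 'k) = of_nat (Suc n) * of_nat (fact n)"
        by (simp only: fact_Suc of_nat_mult of_nat_id)
      moreover have "(of_nat (Suc n) :: 'k) \<noteq> 0" using Suc.prems by (intro char) simp_all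
      ultimately show ?case using Suc by simp
    qed simp
    have "card free_indices \<le> card {1..m}"
      by (rule card_mono) (auto simp: free_indices_def)
    then have "card free_indices \<le> m" by simp
    moreover have "card stab = fact (card free_indices)"
      unfolding stab_def by (rule card_permutations) simp_all
    ultimately show ?thesis using nz by simp
  qed
  ultimately show ?thesis by auto
qed

text \<open>Only the permutations fixing \<open>x\<close> contribute. Their number is nonzero in the
  field, so the sum is nonzero whenever \<open>F x\<close> is.\<close>

lemma average_at_point:
  assumes "\<And>h. h \<in> stab \<Longrightarrow> x \<circ> h \<noteq> x \<Longrightarrow> F (x \<circ> h) = 0"
  shows "(\<Sum>h\<in>stab. F (x \<circ> h)) = of_nat (card {h \<in> stab. x \<circ> h = x}) * (F x :: 'k)"
proof -
  have "(\<Sum>h\<in>stab. F (x \<circ> h)) = (\<Sum>h\<in>{h \<in> stab. x \<circ> h = x}. F (x \<circ> h))"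
    using finite_stab assms by (intro sum.mono_neutral_right) auto
  then show ?thesis by simp
qed

text \<open>
  The stabilizer of a point fixes each of its representatives, as it fixes their projections,
  which are not zero.
\<close>

lemma comp_eq_if_hpoint_eq:
  assumes "x \<in> cone" "h \<in> stab" "hpoint (x \<circ> h) = hpoint x" shows "x \<circ> h = x"
proof -
  obtain c where c: "x \<circ> h = (\<lambda>i. c * x i)"
    using assms(3)[symmetric] unfolding hpoint_eq_iff by blast
  then have "proj x = (\<lambda>s. c * proj x s)"
    using proj_comp[OF assms(2), of x] by (simp add: proj_scale)
  moreover obtain s where "proj x s \<noteq> 0" using proj_nonzero[OF assms(1)] by blast
  ultimately have "c = 1" by (metis mult_cancel_right1)
  then show ?thesis using c by simp
qed

lemma orbit_points_subset: "x \<in> cone \<Longrightarrow> (\<lambda>h. hpoint (x \<circ> h)) ` stab \<subseteq> PG (m - 1)"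
  using V_subset hpoint_in_V cone_comp by blast

text \<open>Otherwise take a form that is nonzero at a representative \<open>z\<close> of the point
  of \<open>x\<close> and zero at the remaining points of the orbits of \<open>z\<close> and
  \<open>y\<close>. Its average is zero at \<open>y\<close> and nonzero at \<open>z\<close>, yet it
  depends on the projection alone.\<close>

lemma proj_fibres:
  assumes x: "x \<in> cone" and y: "y \<in> cone" and eq: "hpoint (proj x) = hpoint (proj y)"
  shows "\<exists>h\<in>stab. hpoint y = hpoint (x \<circ> h)"
proof (rule ccontr)
  assume neg: "\<not> ?thesis"
  obtain c where c: "c \<noteq> 0" "proj y = (\<lambda>s. c * proj x s)"
    using eq unfolding hpoint_eq_iff by blast
  \<comment> \<open>Rescaled so that its projection equals that of \<open>y\<close> as a vector; a
    descended form then takes the very same value at both.\<close>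
  define z where "z = (\<lambda>i. c * x i)"
  have z: "z \<in> cone" "proj z = proj y"
    unfolding z_def using cone_scale[OF x c(1)] c(2) by (simp_all add: proj_scale)
  have zx: "hpoint (z \<circ> h) = hpoint (x \<circ> h)" for h
    by (rule sym) (use c(1) in \<open>auto simp: hpoint_eq_iff z_def o_def\<close>)
  let ?O = "\<lambda>v. (\<lambda>h. hpoint (v \<circ> h)) ` stab"
  \<comment> \<open>Removing \<open>hpoint z\<close> from the two orbits below thus takes nothing
    away from the orbit of \<open>y\<close>.\<close>
  have y_ne: "hpoint (y \<circ> h) \<noteq> hpoint z" if h: "h \<in> stab" for h
  proof
    assume "hpoint (y \<circ> h) = hpoint z"
    then obtain b where b: "b \<noteq> 0" "z = (\<lambda>i. b * (y \<circ> h) i)" unfolding hpoint_eq_iff by blast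
    have "z \<circ> inv' h = (\<lambda>i. b * y i)"
      using stab_inverses(1)[OF h] b(2) by (auto simp: fun_eq_iff)
    then have "hpoint y = hpoint (x \<circ> inv' h)"
      unfolding zx[symmetric] hpoint_eq_iff using b(1) by blast
    then show False using neg inv_in_stab[OF h] by blast
  qed
  define S where "S = ?O z \<union> ?O y - {hpoint z}"
  have "finite S" "S \<subseteq> PG (m-1)" "hpoint z \<in> PG (m-1)" "hpoint z \<notin> S"
    unfolding S_def
    using orbit_points_subset[OF y] orbit_points_subset[OF z(1)] finite_stab
      hpoint_in_V[OF z(1)] V_subset by auto
  then obtain e g where g: "form (m-1) e g" "g z \<noteq> 0" and g_S: "\<forall>Q\<in>S. \<forall>v\<in>Q. g v = 0"
    using form_separating_points by metis
  have g0: "g v = 0" if "hpoint v \<in> S" for v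
    using g_S that hpoint_self by blast
  have "g (y \<circ> h) = 0" if "h \<in> stab" for h
    using y_ne[OF that] that by (intro g0) (simp add: S_def)
  then have "(\<Sum>h\<in>stab. g (y \<circ> h)) = 0" by simp
  moreover have "g (z \<circ> h) = 0" if "h \<in> stab" "z \<circ> h \<noteq> z" for h
    using comp_eq_if_hpoint_eq[OF z(1)] that by (intro g0) (auto simp: S_def)
  then have "(\<Sum>h\<in>stab. g (z \<circ> h)) \<noteq> 0"
    using average_at_point[of z g] g(2) card_stab_fixing_nonzero[of z] by simp
  moreover obtain g' where "\<And>v. v \<in> cone \<Longrightarrow> (\<Sum>h\<in>stab. g (v \<circ> h)) = g' (proj v)"
    using descends_average[OF g(1)] unfolding descends_def by blast
  ultimately show False using y z by metis
qed

text \<open>The product of a form that is nonzero at \<open>x\<close> and zero on the rest of its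
  orbit with one whose non-vanishing set meets \<open>V\<close> inside \<open>W\<close>. It acts as
  a bump function: supported in \<open>W\<close>, with a nonzero average at
  \<open>x\<close>.\<close>

lemma bump_form:
  assumes x: "x \<in> cone" and W: "openin V_top W" "hpoint x \<in> W"
  obtains e g where "form (m-1) e g" "g x \<noteq> 0"
    "\<And>h. h \<in> stab \<Longrightarrow> x \<circ> h \<noteq> x \<Longrightarrow> g (x \<circ> h) = 0"
    "\<And>y. y \<in> cone \<Longrightarrow> g y \<noteq> 0 \<Longrightarrow> hpoint y \<in> W"
proof -
  define S where "S = (\<lambda>h. hpoint (x \<circ> h)) ` stab - {hpoint x}"
  have "finite S" "S \<subseteq> PG (m-1)" "hpoint x \<in> PG (m-1)" "hpoint x \<notin> S"
    unfolding S_def using orbit_points_subset[OF x] finite_stab hpoint_in_V[OF x] V_subset by auto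
  then obtain e g where g: "form (m-1) e g" "g x \<noteq> 0" and g_S: "\<forall>Q\<in>S. \<forall>v\<in>Q. g v = 0"
    using form_separating_points by metis
  obtain e' f where f: "form (m-1) e' f" "hpoint x \<in> nonvanishing (m-1) f"
      "nonvanishing (m-1) f \<inter> V \<subseteq> W"
    using W unfolding openin_subtopology_zariski[OF V_subset] by blast
  have V: "hpoint y \<in> PG (m-1)" "hpoint y \<in> V" if "y \<in> cone" for y
    using hpoint_in_V[OF that] V_subset by auto
  show ?thesis
  proof (rule that)
    show "form (m-1) (e + e') (\<lambda>y. g y * f y)" by (intro form_mult g f)
    show "g x * f x \<noteq> 0" using g(2) f(2) hpoint_in_nonvanishing[OF f(1) V(1)[OF x]] by simp
    show "g (x \<circ> h) * f (x \<circ> h) = 0" if "h \<in> stab" "x \<circ> h \<noteq> x" for h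
    proof -
      have "hpoint (x \<circ> h) \<in> S"
        using comp_eq_if_hpoint_eq[OF x] that unfolding S_def by blast
      then have "g (x \<circ> h) = 0" using g_S hpoint_self by blast
      then show ?thesis by simp
    qed
    show "hpoint y \<in> W" if "y \<in> cone" "g y * f y \<noteq> 0" for y
      using that V[OF that(1)] f(3) hpoint_in_nonvanishing[OF f(1), of y] by auto
  qed
qed

section \<open>Open sets and regular functions under the projection\<close>

lemma form_proj:
  assumes "form (l-1) e f" shows "form (m-1) e (\<lambda>x. f (proj x))"
proof (rule form_substitute_coords[OF assms])
  fix s assume "s \<in> {1..l - 1 + 1}"
  then have s: "s \<in> {1..l}" using l_ge by simp
  have "j s \<in> {1..m - 1 + 1}" using j_in[OF s] m_ge by simp
  then have "form (m-1) 1 (\<lambda>x. x (j s) :: 'k)" by (rule form_coord)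
  then show "form (m-1) 1 (\<lambda>x. proj x s)" unfolding proj_def using s by simp
qed

text \<open>Forms on the target pull back, which shows continuity. Conversely, the average of a bump
  form at a preimage of \<open>Q\<close> descends, and its non-vanishing set cuts out a
  neighbourhood of \<open>Q\<close> inside \<open>U\<close>.\<close>

lemma openin_preimage_project_iff:
  assumes "U \<subseteq> V_proj"
  shows "openin V_top {P \<in> V. project l j P \<in> U} \<longleftrightarrow> openin V_proj_top U"
proof
  assume U: "openin V_proj_top U"
  show "openin V_top {P \<in> V. project l j P \<in> U}"
    unfolding openin_subtopology_zariski[OF V_subset]
  proof (intro conjI ballI)
    fix P assume "P \<in> {P \<in> V. project l j P \<in> U}"
    then obtain x where x: "x \<in> cone" "P = hpoint x" "hpoint (proj x) \<in> U"
      unfolding V_eq by (auto simp: project_hpoint)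
    obtain e f where f: "form (l-1) e f" "hpoint (proj x) \<in> nonvanishing (l-1) f"
        "nonvanishing (l-1) f \<inter> V_proj \<subseteq> U"
      using U x(3) unfolding openin_subtopology_zariski[OF V_proj_subset] by blast
    have iff: "hpoint y \<in> nonvanishing (m-1) (\<lambda>x. f (proj x)) \<longleftrightarrow>
        hpoint (proj y) \<in> nonvanishing (l-1) f" if y: "y \<in> cone" for y
    proof -
      have "hpoint y \<in> PG (m-1)" "hpoint (proj y) \<in> PG (l-1)"
        using y hpoint_in_V V_subset V_proj_subset unfolding V_proj_eq by auto
      then show ?thesis using hpoint_in_nonvanishing form_proj f(1) by blast
    qed
    have "R \<in> {P \<in> V. project l j P \<in> U}" if R: "R \<in> nonvanishing (m-1) (\<lambda>x. f (proj x))" "R \<in> V" for R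
    proof -
      obtain y where y: "y \<in> cone" "R = hpoint y" using R(2) unfolding V_eq by blast
      then have "hpoint (proj y) \<in> nonvanishing (l-1) f \<inter> V_proj"
        using iff[OF y(1)] R(1) unfolding V_proj_eq by blast
      then show ?thesis using f(3) R(2) y(2) by (auto simp: project_hpoint)
    qed
    then have "nonvanishing (m-1) (\<lambda>x. f (proj x)) \<inter> V \<subseteq> {P \<in> V. project l j P \<in> U}" by blast
    then show "\<exists>e f. form (m-1) e f \<and> P \<in> nonvanishing (m-1) f \<and>
        nonvanishing (m-1) f \<inter> V \<subseteq> {P \<in> V. project l j P \<in> U}"
      using form_proj[OF f(1)] iff[OF x(1)] f(2) x(2) by blast
  qed blast
next
  assume U: "openin V_top {P \<in> V. project l j P \<in> U}"
  show "openin V_proj_top U"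
    unfolding openin_subtopology_zariski[OF V_proj_subset]
  proof (intro conjI ballI assms)
    fix Q assume "Q \<in> U"
    then obtain x where x: "x \<in> cone" "Q = hpoint (proj x)" using assms unfolding V_proj_eq by blast
    have "hpoint x \<in> {P \<in> V. project l j P \<in> U}"
      using x \<open>Q \<in> U\<close> hpoint_in_V by (simp add: project_hpoint)
    then obtain e g where g: "form (m-1) e g" "g x \<noteq> 0"
        "\<And>h. h \<in> stab \<Longrightarrow> x \<circ> h \<noteq> x \<Longrightarrow> g (x \<circ> h) = 0"
        "\<And>y. y \<in> cone \<Longrightarrow> g y \<noteq> 0 \<Longrightarrow> hpoint y \<in> {P \<in> V. project l j P \<in> U}"
      using bump_form[OF x(1) U] by blast
    obtain g' where g': "form (l-1) e g'" "\<And>v. v \<in> cone \<Longrightarrow> (\<Sum>h\<in>stab. g (v \<circ> h)) = g' (proj v)"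
      using descends_average[OF g(1)] unfolding descends_def by blast
    have "(\<Sum>h\<in>stab. g (x \<circ> h)) \<noteq> 0"
      using average_at_point[of x g] g(2,3) card_stab_fixing_nonzero[of x] by simp
    then have "g' (proj x) \<noteq> 0" using g'(2)[OF x(1)] by simp
    then have "Q \<in> nonvanishing (l-1) g'"
      using hpoint_in_nonvanishing[OF g'(1)] x V_proj_subset unfolding V_proj_eq by blast
    moreover have "R \<in> U" if R: "R \<in> nonvanishing (l-1) g'" "R \<in> V_proj" for R
    proof -
      obtain y where y: "y \<in> cone" "R = hpoint (proj y)" using R(2) unfolding V_proj_eq by blast
      have "(\<Sum>h\<in>stab. g (y \<circ> h)) \<noteq> 0"
        using R(1) hpoint_self[of "proj y"] g'(2)[OF y(1)] unfolding nonvanishing_def y(2) by auto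
      \<comment> \<open>A nonzero average has a nonzero term, so some translate of \<open>y\<close>
        lies over \<open>U\<close>; it has the same projection as \<open>y\<close>.\<close>
      then obtain h where h: "h \<in> stab" "g (y \<circ> h) \<noteq> 0" by (meson sum.neutral)
      then have "project l j (hpoint (y \<circ> h)) \<in> U" using g(4) cone_comp[OF y(1)] by blast
      then show ?thesis by (simp add: project_hpoint proj_comp[OF h(1)] y(2))
    qed
    ultimately show "\<exists>e f. form (l-1) e f \<and> Q \<in> nonvanishing (l-1) f \<and>
        nonvanishing (l-1) f \<inter> V_proj \<subseteq> U"
      using g'(1) by blast
  qed
qed

text \<open>A local quotient \<open>a / b\<close> on \<open>V\<close> becomes one on the image by
  multiplying \<open>a\<close> and \<open>b\<close> with a bump form and averaging both products.
  \<open>F\<close> is tied to \<open>f\<close> on \<open>V\<close> only, since functions are total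
  and the pullback through orbits may take other values elsewhere.\<close>

lemma regular_pullback_project_iff:
  assumes U: "openin V_proj_top U" and F: "\<And>P. P \<in> V \<Longrightarrow> F P = f (project l j P)"
  shows "F \<in> regular (variety (m-1) V) {P \<in> V. project l j P \<in> U} \<longleftrightarrow>
         f \<in> regular (variety (l-1) V_proj) U"
proof
  assume f: "f \<in> regular (variety (l-1) V_proj) U"
  show "F \<in> regular (variety (m-1) V) {P \<in> V. project l j P \<in> U}"
    unfolding regular_variety
  proof
    fix P assume P: "P \<in> {P \<in> V. project l j P \<in> U}"
    then have "project l j P \<in> U" by simp
    from bspec[OF f[unfolded regular_variety] this]
    obtain W e a b where W: "openin V_proj_top W" "project l j P \<in> W" "W \<subseteq> U"
      and ab: "form (l-1) e a" "form (l-1) e b"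
      and q: "\<forall>Q\<in>W. \<forall>x\<in>Q. b x \<noteq> 0 \<and> f Q = a x / b x"
      by (elim exE conjE) (rule that)
    let ?W = "{P \<in> V. project l j P \<in> W}"
    have "W \<subseteq> V_proj" using openin_subset[OF W(1)] by simp
    then have "openin V_top ?W" using openin_preimage_project_iff W(1) by blast
    moreover have "b (proj x) \<noteq> 0 \<and> F Q = a (proj x) / b (proj x)" if "Q \<in> ?W" "x \<in> Q" for Q x
    proof -
      have "Q = hpoint x" using that V_E by blast
      then have "proj x \<in> project l j Q" by (simp add: project_hpoint hpoint_self)
      then show ?thesis using q that F by auto
    qed
    ultimately show "\<exists>W e a b. openin V_top W \<and> P \<in> W \<and> W \<subseteq> {P \<in> V. project l j P \<in> U} \<and>
        form (m-1) e a \<and> form (m-1) e b \<and> (\<forall>Q\<in>W. \<forall>x\<in>Q. b x \<noteq> 0 \<and> F Q = a x / b x)"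
      using P W(2,3)
      by (intro exI[of _ ?W] exI[of _ e] exI[of _ "\<lambda>x. a (proj x)"] exI[of _ "\<lambda>x. b (proj x)"]
          conjI form_proj ab) auto
  qed
next
  assume FR: "F \<in> regular (variety (m-1) V) {P \<in> V. project l j P \<in> U}"
  have U_sub: "U \<subseteq> V_proj" using openin_subset[OF U] by simp
  show "f \<in> regular (variety (l-1) V_proj) U"
    unfolding regular_variety
  proof
    fix Q assume "Q \<in> U"
    then obtain x where x: "x \<in> cone" "Q = hpoint (proj x)" using U_sub unfolding V_proj_eq by blast
    have "hpoint x \<in> {P \<in> V. project l j P \<in> U}"
      using x \<open>Q \<in> U\<close> hpoint_in_V by (simp add: project_hpoint)
    from bspec[OF FR[unfolded regular_variety] this]
    obtain W e a b where W: "openin V_top W" "hpoint x \<in> W" "W \<subseteq> {P \<in> V. project l j P \<in> U}"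
      and ab: "form (m-1) e a" "form (m-1) e b"
      and q: "\<forall>P\<in>W. \<forall>y\<in>P. b y \<noteq> 0 \<and> F P = a y / b y"
      by (elim exE conjE) (rule that)
    obtain e' g where g: "form (m-1) e' g" "g x \<noteq> 0"
        "\<And>h. h \<in> stab \<Longrightarrow> x \<circ> h \<noteq> x \<Longrightarrow> g (x \<circ> h) = 0"
        "\<And>y. y \<in> cone \<Longrightarrow> g y \<noteq> 0 \<Longrightarrow> hpoint y \<in> W"
      using bump_form[OF x(1) W(1,2)] by blast
    obtain a' where a': "form (l-1) (e + e') a'"
        "\<And>v. v \<in> cone \<Longrightarrow> (\<Sum>h\<in>stab. a (v \<circ> h) * g (v \<circ> h)) = a' (proj v)"
      using descends_average[OF form_mult[OF ab(1) g(1)]] unfolding descends_def by blast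
    obtain b' where b': "form (l-1) (e + e') b'"
        "\<And>v. v \<in> cone \<Longrightarrow> (\<Sum>h\<in>stab. b (v \<circ> h) * g (v \<circ> h)) = b' (proj v)"
      using descends_average[OF form_mult[OF ab(2) g(1)]] unfolding descends_def by blast
    \<comment> \<open>This holds for every cone vector: a translate where \<open>g\<close> is
      nonzero lies in \<open>W\<close>, where \<open>F = a / b\<close>, and for the others both
      sides are zero. The factor \<open>f\<close> is common to all translates, so the terms can be
      summed.\<close>
    have quot: "f (hpoint (proj y)) * b' (proj y) = a' (proj y)" if y: "y \<in> cone" for y
    proof -
      have "f (hpoint (proj y)) * (b (y \<circ> h) * g (y \<circ> h)) = a (y \<circ> h) * g (y \<circ> h)"
        if h: "h \<in> stab" for h
      proof (cases "g (y \<circ> h) = 0")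
        case False
        have yh: "y \<circ> h \<in> cone" using cone_comp[OF y h] .
        have "F (hpoint (y \<circ> h)) = f (hpoint (proj y))"
          using F[OF hpoint_in_V[OF yh]] by (simp add: project_hpoint proj_comp[OF h])
        moreover have "b (y \<circ> h) \<noteq> 0" "F (hpoint (y \<circ> h)) = a (y \<circ> h) / b (y \<circ> h)"
          using bspec[OF bspec[OF q g(4)[OF yh False]] hpoint_self] by auto
        ultimately have "f (hpoint (proj y)) * b (y \<circ> h) = a (y \<circ> h)"
          by (metis nonzero_eq_divide_eq)
        then show ?thesis by (metis mult.assoc)
      qed simp
      then show ?thesis
        unfolding a'(2)[OF y, symmetric] b'(2)[OF y, symmetric] sum_distrib_left
        by (intro sum.cong) auto
    qed
    have "b x \<noteq> 0" using bspec[OF bspec[OF q W(2)] hpoint_self] by simp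
    then have "(\<Sum>h\<in>stab. b (x \<circ> h) * g (x \<circ> h)) \<noteq> 0"
      using average_at_point[of x "\<lambda>v. b v * g v"] g(2,3) card_stab_fixing_nonzero[of x] by simp
    then have "b' (proj x) \<noteq> 0" using b'(2)[OF x(1)] by simp
    then have Q: "Q \<in> nonvanishing (l-1) b'"
      using hpoint_in_nonvanishing[OF b'(1)] x V_proj_subset unfolding V_proj_eq by blast
    let ?W = "U \<inter> (nonvanishing (l-1) b' \<inter> V_proj)"
    have "openin V_proj_top ?W"
      by (intro openin_Int U openin_nonvanishing[OF V_proj_subset b'(1)])
    moreover have "b' z \<noteq> 0 \<and> f R = a' z / b' z" if R: "R \<in> ?W" "z \<in> R" for R z
    proof -
      have "b' z \<noteq> 0" using R unfolding nonvanishing_def by blast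
      moreover obtain y where "y \<in> cone" "z = proj y" "R = hpoint (proj y)"
        using V_proj_E R by blast
      ultimately show ?thesis using quot[of y] by (simp add: field_simps)
    qed
    ultimately show "\<exists>W e a b. openin V_proj_top W \<and> Q \<in> W \<and> W \<subseteq> U \<and>
        form (l-1) e a \<and> form (l-1) e b \<and> (\<forall>Q\<in>W. \<forall>x\<in>Q. b x \<noteq> 0 \<and> f Q = a x / b x)"
      using Q \<open>Q \<in> U\<close> U_sub
      by (intro exI[of _ ?W] exI[of _ "e + e'"] exI[of _ a'] exI[of _ b'] conjI a'(1) b'(1)) auto
  qed
qed

section \<open>The induced map on orbits\<close>

lemma quotient_isomorphic_projection:
  "isomorphic (quotient_variety group_H permute_coords (variety (m-1) V)) (variety (l-1) V_proj)"
    (is "isomorphic ?Q ?Y")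
proof -
  let ?orb = "orbit group_H permute_coords :: 'k ppoint \<Rightarrow> 'k ppoint set"
  \<comment> \<open>Any point of the orbit may be chosen, as the stabilizer leaves the projected
    coordinates alone.\<close>
  define \<phi> where "\<phi> O' = project l j (SOME P. P \<in> O')" for O' :: "'k ppoint set"
  have topV: "topol (variety (m-1) V) = V_top" "topspace V_top = V"
    using V_subset by (auto simp: variety_def)
  have topY: "topol ?Y = V_proj_top" "topspace V_proj_top = V_proj"
    using V_proj_subset by (auto simp: variety_def)
  have orbits: "orbits group_H V permute_coords = ?orb ` V"
    unfolding orbits_def by blast
  have openQ: "openin (topol ?Q) U \<longleftrightarrow> U \<subseteq> orbits group_H V permute_coords \<and>
      openin V_top {P \<in> V. ?orb P \<in> U}" for U
    unfolding openin_quotient_variety topV ..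
  have "{P \<in> V. ?orb P \<in> orbits group_H V permute_coords} = V"
    unfolding orbits by blast
  then have "openin (topol ?Q) (orbits group_H V permute_coords)"
    unfolding openQ using openin_topspace[of V_top] by (simp only: topV subset_refl simp_thms)
  then have topQ: "topspace (topol ?Q) = ?orb ` V"
    using openQ openin_subset openin_topspace unfolding orbits by blast
  have phi: "\<phi> (?orb P) = project l j P" if P: "P \<in> V" for P
  proof -
    obtain x where x: "x \<in> cone" "P = hpoint x" using P unfolding V_eq by blast
    have "hpoint (x \<circ> id) \<in> ?orb P"
      unfolding x(2) orbit_hpoint using id_in_stab by (rule imageI)
    then have "(SOME P'. P' \<in> ?orb P) \<in> ?orb P" by (rule someI)
    then obtain h where "h \<in> stab" "(SOME P'. P' \<in> ?orb P) = hpoint (x \<circ> h)"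
      unfolding x(2) orbit_hpoint by blast
    then show ?thesis unfolding \<phi>_def x(2) by (simp add: project_hpoint proj_comp)
  qed
  have pre: "{P \<in> V. ?orb P \<in> {O' \<in> topspace (topol ?Q). \<phi> O' \<in> U}} = {P \<in> V. project l j P \<in> U}" for U
    unfolding topQ by (auto simp: phi)
  \<comment> \<open>The homeomorphism is obtained as an injective quotient map, so continuity of the
    inverse needs no separate argument.\<close>
  have "quotient_map (topol ?Q) (topol ?Y) \<phi>"
    unfolding quotient_map_def
  proof (intro conjI allI impI)
    show "\<phi> ` topspace (topol ?Q) = topspace (topol ?Y)"
      unfolding topQ topY image_image using phi by (intro image_cong) simp_all
    fix U assume "U \<subseteq> topspace (topol ?Y)"
    then have "openin V_top {P \<in> V. project l j P \<in> U} \<longleftrightarrow> openin V_proj_top U"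
      by (intro openin_preimage_project_iff) (simp only: topY)
    then show "openin (topol ?Q) {O' \<in> topspace (topol ?Q). \<phi> O' \<in> U} \<longleftrightarrow> openin (topol ?Y) U"
      unfolding openQ pre topY using topQ orbits by blast
  qed
  moreover have "inj_on \<phi> (topspace (topol ?Q))"
    unfolding topQ
  proof (rule inj_onI, elim imageE)
    fix O1 O2 P R assume "\<phi> O1 = \<phi> O2" and O: "O1 = ?orb P" "P \<in> V" "O2 = ?orb R" "R \<in> V"
    then have eq: "project l j P = project l j R" by (simp add: phi)
    obtain x y where x: "x \<in> cone" "P = hpoint x" and y: "y \<in> cone" "R = hpoint y"
      using O unfolding V_eq by blast
    \<comment> \<open>\<open>proj_fibres\<close> puts the point of \<open>v\<close> in the orbit of
      that of \<open>u\<close>; exchanging the two gives equality of the orbits.\<close>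
    have sub: "?orb (hpoint v) \<subseteq> ?orb (hpoint u)"
      if uv: "u \<in> cone" "v \<in> cone" "hpoint (proj u) = hpoint (proj v)" for u v
    proof -
      obtain h where h: "h \<in> stab" "hpoint v = hpoint (u \<circ> h)"
        using proj_fibres[OF uv] by blast
      have "hpoint (u \<circ> h \<circ> h') \<in> ?orb (hpoint u)" if "h' \<in> stab" for h'
        unfolding orbit_hpoint comp_assoc using comp_in_stab[OF h(1) that] by blast
      then show ?thesis unfolding h(2) orbit_hpoint[of "u \<circ> h"] by blast
    qed
    show "O1 = O2"
      using sub[of x y] sub[of y x] x y eq unfolding O by (simp add: project_hpoint subset_antisym)
  qed
  ultimately have "homeomorphic_map (topol ?Q) (topol ?Y) \<phi>"
    unfolding homeomorphic_map_def ..
  moreover have "f \<in> regular ?Y U \<longleftrightarrow>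
      f \<circ> \<phi> \<in> regular ?Q {O' \<in> topspace (topol ?Q). \<phi> O' \<in> U}" if "openin (topol ?Y) U" for U f
  proof -
    have "f \<circ> \<phi> \<in> regular ?Q {O' \<in> topspace (topol ?Q). \<phi> O' \<in> U} \<longleftrightarrow>
        (f \<circ> \<phi>) \<circ> ?orb \<in> regular (variety (m-1) V)
          {P \<in> V. ?orb P \<in> {O' \<in> topspace (topol ?Q). \<phi> O' \<in> U}}"
      by (subst (1) quotient_variety_def) (simp only: space_with_functions.simps topV mem_Collect_eq)
    also have "\<dots> \<longleftrightarrow> f \<in> regular ?Y U"
      unfolding pre using that by (intro regular_pullback_project_iff) (simp_all only: topY phi comp_apply)
    finally show ?thesis by simp
  qed
  ultimately show ?thesis unfolding isomorphic_def by blast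
qed

end

theorem proposition6p1:
  fixes m l :: nat and j :: "nat \<Rightarrow> nat"
  assumes "CHAR('k::alg_closed_field) = 0 \<or>
           (prime CHAR('k) \<and> CHAR('k) \<ge> 7 \<and> m \<le> CHAR('k) - 1)"
    and "m \<ge> 5"
    and "2 \<le> l" and "l \<le> m - 1"
    and "inj_on j {1..l}" and "j ` {1..l} \<subseteq> {1..m}"
  shows "isomorphic
           (quotient_variety (coord_stabilizer m l j) permute_coords
              (variety (m-1) (curveV m :: 'k ppoint set)))
           (variety (l-1) (project l j ` (curveV m :: 'k ppoint set)))"
proof -
  \<comment> \<open>A number \<open>n\<close> with \<open>0 < n \<le> m\<close> is no multiple of
    the characteristic: not of 0 because it is positive, not of \<open>p\<close> because
    \<open>m < p\<close>.\<close>
  have "(of_nat n :: 'k) \<noteq> 0" if "0 < n" "n \<le> m" for n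
    using that assms(1) by (auto simp: of_nat_eq_0_iff_char_dvd dest: dvd_imp_le)
  then interpret projected_curve m l j "TYPE('k)"
    using assms(3-6) by unfold_locales auto
  show ?thesis by (rule quotient_isomorphic_projection)
qed

end
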